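(* Let $(\Omega,\mathcal{F})$ be a measurable space, $\mathcal{P}$ a nonempty set of probability measures on $(\Omega,\mathcal{F})$ and $c(A)=\sup_{P\in\mathcal{P}}P(A)$. If $ca_c^\ast=L^\infty_c$, then $L^\infty_c$ is order complete, i.e. every nonempty norm bounded set $\mathcal{D}\subset L^\infty_c$ has a supremum in $L^\infty_c$. Conversely, if $L^\infty_c$ is order complete and if the order continuous dual of $L^\infty_c$ may be identified with $ca_c$, then $ca_c^\ast=L^\infty_c$.
   Context: A statement holds $\mathcal{P}$-q.s. if it holds $P$-almost surely for every $P\in\mathcal{P}$. $ca$ is the space of all $\sigma$-additive $\mu:\mathcal{F}\to\mathbb{R}$ (finite signed measures) with the total variation norm, and $ca_c=\{\mu\in ca\mid c(A)=0\Rightarrow\mu(A)=0 \text{ for all } A\in\mathcal{F}\}$, with the same norm. $L^\infty_c$ is the space of bounded $\mathcal{F}$-measurable functions $\Omega\to\mathbb{R}$ modulo $\mathcal{P}$-q.s. equality, a Banach lattice with norm $\|X\|_{c,\infty}=\inf\{m\mid \forall P\in\mathcal{P}: P(|X|\le m)=1\}$ and order $X\le Y$ iff $X\le Y$ $\mathcal{P}$-q.s. A supremum of $\mathcal{D}$ is a least upper bound of $\mathcal{D}$ in this order. $ca_c^\ast$ is the norm dual of $ca_c$. Every $X\in L^\infty_c$ defines an element of $ca_c^\ast$ by $\mu\mapsto\int X\,d\mu$; $ca_c^\ast=L^\infty_c$ means that every element of $ca_c^\ast$ is of this form. The order continuous dual of $L^\infty_c$ is the space of all order bounded linear functionals $l:L^\infty_c\to\mathbb{R}$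 which are order continuous, i.e. $l(X_\alpha)\to 0$ for every net $(X_\alpha)$ converging in order to $0$. That it may be identified with $ca_c$ means that the map sending $\mu\in ca_c$ to the functional $X\mapsto\int X\,d\mu$ is a bijection from $ca_c$ onto the order continuous dual of $L^\infty_c$. *)

theory Defs
  imports "HOL-Probability.Probability"
begin

text \<open>
  The measurable space $(\Omega,\mathcal F)$ is given by \<open>space M\<close> and \<open>sets M\<close> of a measure
  \<open>M\<close> whose own measure function plays no role; \<open>\<P>\<close> is a set of probability measures on it.
\<close>

definition qs :: "'a measure set \<Rightarrow> ('a \<Rightarrow> bool) \<Rightarrow> bool" where
  "qs \<P> Q \<longleftrightarrow> (\<forall>P\<in>\<P>. AE \<omega> in P. Q \<omega>)"

definition cap :: "'a measure set \<Rightarrow> 'a set \<Rightarrow> real" where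
  "cap \<P> A = (SUP P\<in>\<P>. measure P A)"


section \<open>Finite signed measures\<close>

text \<open>Set functions are normalised to be 0 outside \<open>sets M\<close>, so that equality in \<open>ca M\<close> is
  equality on \<open>sets M\<close>, and pointwise sums and multiples stay in \<open>ca M\<close>.\<close>

definition ca :: "'a measure \<Rightarrow> ('a set \<Rightarrow> real) set" where
  "ca M = {\<mu>. (\<forall>A. A \<notin> sets M \<longrightarrow> \<mu> A = 0) \<and>
     (\<forall>A::nat \<Rightarrow> 'a set. range A \<subseteq> sets M \<longrightarrow> disjoint_family A \<longrightarrow>
        (\<lambda>n. \<mu> (A n)) sums \<mu> (\<Union>n. A n))}"

definition tv_norm :: "'a measure \<Rightarrow> ('a set \<Rightarrow> real) \<Rightarrow> real" where
  "tv_norm M \<mu> =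
     (SUP \<A>\<in>{\<A>. finite \<A> \<and> \<A> \<subseteq> sets M \<and> partition_on (space M) \<A>}. \<Sum>A\<in>\<A>. \<bar>\<mu> A\<bar>)"

definition ca_c :: "'a measure \<Rightarrow> 'a measure set \<Rightarrow> ('a set \<Rightarrow> real) set" where
  "ca_c M \<P> = {\<mu> \<in> ca M. \<forall>A\<in>sets M. cap \<P> A = 0 \<longrightarrow> \<mu> A = 0}"

text \<open>Positive part in the Jordan decomposition:
  $\mu^+(A)=\sup\{\mu(B)\mid B\in\mathcal F,\ B\subseteq A\}$; the negative part is $(-\mu)^+$.\<close>

definition pos_part :: "'a measure \<Rightarrow> ('a set \<Rightarrow> real) \<Rightarrow> 'a measure" where
  "pos_part M \<mu> = measure_of (space M) (sets M)
     (\<lambda>A. ennreal (SUP B\<in>{B\<in>sets M. B \<subseteq> A}. \<mu> B))"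

definition signed_integral :: "'a measure \<Rightarrow> ('a set \<Rightarrow> real) \<Rightarrow> ('a \<Rightarrow> real) \<Rightarrow> real" where
  "signed_integral M \<mu> X =
     (\<integral>\<omega>. X \<omega> \<partial>pos_part M \<mu>) - (\<integral>\<omega>. X \<omega> \<partial>pos_part M (\<lambda>A. - \<mu> A))"

text \<open>The functionals themselves, like those on $L^\infty_c$ below, are only relevant on their domain
  and are normalised outside it by \<open>extensional\<close>.\<close>

definition ca_c_dual :: "'a measure \<Rightarrow> 'a measure set \<Rightarrow> (('a set \<Rightarrow> real) \<Rightarrow> real) set" where
  "ca_c_dual M \<P> = {\<phi> \<in> extensional (ca_c M \<P>).
     (\<forall>\<mu>\<in>ca_c M \<P>. \<forall>\<nu>\<in>ca_c M \<P>. \<phi> (\<lambda>A. \<mu> A + \<nu> A) = \<phi> \<mu> + \<phi> \<nu>) \<and>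
     (\<forall>r. \<forall>\<mu>\<in>ca_c M \<P>. \<phi> (\<lambda>A. r * \<mu> A) = r * \<phi> \<mu>) \<and>
     (\<exists>K. \<forall>\<mu>\<in>ca_c M \<P>. \<bar>\<phi> \<mu>\<bar> \<le> K * tv_norm M \<mu>)}"


section \<open>The space $L^\infty_c$\<close>

definition bdd_measurable :: "'a measure \<Rightarrow> ('a \<Rightarrow> real) set" where
  "bdd_measurable M = {X \<in> borel_measurable M. bounded (X ` space M)}"

definition qs_rel :: "'a measure \<Rightarrow> 'a measure set \<Rightarrow> (('a \<Rightarrow> real) \<times> ('a \<Rightarrow> real)) set" where
  "qs_rel M \<P> = {(X, Y). X \<in> bdd_measurable M \<and> Y \<in> bdd_measurable M \<and> qs \<P> (\<lambda>\<omega>. X \<omega> = Y \<omega>)}"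

definition Linf :: "'a measure \<Rightarrow> 'a measure set \<Rightarrow> ('a \<Rightarrow> real) set set" where
  "Linf M \<P> = bdd_measurable M // qs_rel M \<P>"

definition cls :: "'a measure \<Rightarrow> 'a measure set \<Rightarrow> ('a \<Rightarrow> real) \<Rightarrow> ('a \<Rightarrow> real) set" where
  "cls M \<P> X = qs_rel M \<P> `` {X}"

definition rep :: "('a \<Rightarrow> real) set \<Rightarrow> 'a \<Rightarrow> real" where
  "rep a = (SOME X. X \<in> a)"

definition Linf_le :: "'a measure set \<Rightarrow> ('a \<Rightarrow> real) set \<Rightarrow> ('a \<Rightarrow> real) set \<Rightarrow> bool" where
  "Linf_le \<P> a b \<longleftrightarrow> (\<exists>X\<in>a. \<exists>Y\<in>b. qs \<P> (\<lambda>\<omega>. X \<omega> \<le> Y \<omega>))"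

definition Linf_norm :: "'a measure set \<Rightarrow> ('a \<Rightarrow> real) set \<Rightarrow> real" where
  "Linf_norm \<P> a = Inf {m. \<forall>P\<in>\<P>. measure P {\<omega>\<in>space P. \<bar>rep a \<omega>\<bar> \<le> m} = 1}"

definition Linf_abs :: "'a measure \<Rightarrow> 'a measure set \<Rightarrow> ('a \<Rightarrow> real) set \<Rightarrow> ('a \<Rightarrow> real) set" where
  "Linf_abs M \<P> a = cls M \<P> (\<lambda>\<omega>. \<bar>rep a \<omega>\<bar>)"

definition is_supremum ::
    "'a measure \<Rightarrow> 'a measure set \<Rightarrow> ('a \<Rightarrow> real) set set \<Rightarrow> ('a \<Rightarrow> real) set \<Rightarrow> bool" where
  "is_supremum M \<P> D s \<longleftrightarrow> s \<in> Linf M \<P> \<and> (\<forall>d\<in>D. Linf_le \<P> d s) \<and>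
     (\<forall>u\<in>Linf M \<P>. (\<forall>d\<in>D. Linf_le \<P> d u) \<longrightarrow> Linf_le \<P> s u)"

definition is_infimum ::
    "'a measure \<Rightarrow> 'a measure set \<Rightarrow> ('a \<Rightarrow> real) set set \<Rightarrow> ('a \<Rightarrow> real) set \<Rightarrow> bool" where
  "is_infimum M \<P> D s \<longleftrightarrow> s \<in> Linf M \<P> \<and> (\<forall>d\<in>D. Linf_le \<P> s d) \<and>
     (\<forall>u\<in>Linf M \<P>. (\<forall>d\<in>D. Linf_le \<P> u d) \<longrightarrow> Linf_le \<P> u s)"

definition Linf_order_complete :: "'a measure \<Rightarrow> 'a measure set \<Rightarrow> bool" where
  "Linf_order_complete M \<P> \<longleftrightarrow>
     (\<forall>D. D \<subseteq> Linf M \<P> \<longrightarrow> D \<noteq> {} \<longrightarrow> (\<exists>K. \<forall>a\<in>D. Linf_norm \<P> a \<le> K) \<longrightarrow>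
        (\<exists>s. is_supremum M \<P> D s))"


section \<open>The order continuous dual\<close>

text \<open>Nets are indexed by a set \<open>I\<close> directed by the preorder \<open>r\<close>.\<close>

definition directed_set :: "'i set \<Rightarrow> ('i \<Rightarrow> 'i \<Rightarrow> bool) \<Rightarrow> bool" where
  "directed_set I r \<longleftrightarrow> I \<noteq> {} \<and> (\<forall>i\<in>I. r i i) \<and>
     (\<forall>i\<in>I. \<forall>j\<in>I. \<forall>k\<in>I. r i j \<longrightarrow> r j k \<longrightarrow> r i k) \<and>
     (\<forall>i\<in>I. \<forall>j\<in>I. \<exists>k\<in>I. r i k \<and> r j k)"

text \<open>Order convergence to 0: $|X_\alpha|\le Y_\alpha$ for a net $Y_\alpha\downarrow 0$ with the
  same index set.\<close>

definition order_converges_zero ::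
    "'a measure \<Rightarrow> 'a measure set \<Rightarrow> 'i set \<Rightarrow> ('i \<Rightarrow> 'i \<Rightarrow> bool) \<Rightarrow> ('i \<Rightarrow> ('a \<Rightarrow> real) set) \<Rightarrow> bool" where
  "order_converges_zero M \<P> I r X \<longleftrightarrow>
     (\<exists>Y. (\<forall>i\<in>I. Y i \<in> Linf M \<P>) \<and>
          (\<forall>i\<in>I. \<forall>j\<in>I. r i j \<longrightarrow> Linf_le \<P> (Y j) (Y i)) \<and>
          is_infimum M \<P> (Y ` I) (cls M \<P> (\<lambda>_. 0)) \<and>
          (\<forall>i\<in>I. Linf_le \<P> (Linf_abs M \<P> (X i)) (Y i)))"

definition net_null :: "'i set \<Rightarrow> ('i \<Rightarrow> 'i \<Rightarrow> bool) \<Rightarrow> ('i \<Rightarrow> real) \<Rightarrow> bool" where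
  "net_null I r x \<longleftrightarrow> (\<forall>\<epsilon>>0. \<exists>i\<^sub>0\<in>I. \<forall>i\<in>I. r i\<^sub>0 i \<longrightarrow> \<bar>x i\<bar> < \<epsilon>)"

text \<open>A definition cannot quantify over all index types, so the indices are taken from the type
  of elements of $L^\infty_c$. This is no restriction: see \<open>order_continuous_all_nets\<close> below.\<close>

definition order_continuous ::
    "'a measure \<Rightarrow> 'a measure set \<Rightarrow> (('a \<Rightarrow> real) set \<Rightarrow> real) \<Rightarrow> bool" where
  "order_continuous M \<P> l \<longleftrightarrow>
     (\<forall>(I :: ('a \<Rightarrow> real) set set) r X. directed_set I r \<longrightarrow> (\<forall>i\<in>I. X i \<in> Linf M \<P>) \<longrightarrow>
        order_converges_zero M \<P> I r X \<longrightarrow> net_null I r (\<lambda>i. l (X i)))"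

definition Linf_linear :: "'a measure \<Rightarrow> 'a measure set \<Rightarrow> (('a \<Rightarrow> real) set \<Rightarrow> real) \<Rightarrow> bool" where
  "Linf_linear M \<P> l \<longleftrightarrow>
     (\<forall>X\<in>bdd_measurable M. \<forall>Y\<in>bdd_measurable M.
        l (cls M \<P> (\<lambda>\<omega>. X \<omega> + Y \<omega>)) = l (cls M \<P> X) + l (cls M \<P> Y)) \<and>
     (\<forall>r. \<forall>X\<in>bdd_measurable M. l (cls M \<P> (\<lambda>\<omega>. r * X \<omega>)) = r * l (cls M \<P> X))"

definition order_bounded :: "'a measure \<Rightarrow> 'a measure set \<Rightarrow> (('a \<Rightarrow> real) set \<Rightarrow> real) \<Rightarrow> bool" where
  "order_bounded M \<P> l \<longleftrightarrow>
     (\<forall>a\<in>Linf M \<P>. \<forall>b\<in>Linf M \<P>. \<exists>K. \<forall>x\<in>Linf M \<P>.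
        Linf_le \<P> a x \<longrightarrow> Linf_le \<P> x b \<longrightarrow> \<bar>l x\<bar> \<le> K)"

definition order_continuous_dual ::
    "'a measure \<Rightarrow> 'a measure set \<Rightarrow> (('a \<Rightarrow> real) set \<Rightarrow> real) set" where
  "order_continuous_dual M \<P> = {l \<in> extensional (Linf M \<P>).
     Linf_linear M \<P> l \<and> order_bounded M \<P> l \<and> order_continuous M \<P> l}"


section \<open>The two identifications\<close>

definition ca_c_dual_eq_Linf :: "'a measure \<Rightarrow> 'a measure set \<Rightarrow> bool" where
  "ca_c_dual_eq_Linf M \<P> \<longleftrightarrow>
     (\<forall>\<phi>\<in>ca_c_dual M \<P>. \<exists>a\<in>Linf M \<P>. \<forall>\<mu>\<in>ca_c M \<P>. \<phi> \<mu> = signed_integral M \<mu> (rep a))"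

definition order_continuous_dual_eq_ca_c :: "'a measure \<Rightarrow> 'a measure set \<Rightarrow> bool" where
  "order_continuous_dual_eq_ca_c M \<P> \<longleftrightarrow>
     bij_betw (\<lambda>\<mu>. \<lambda>a\<in>Linf M \<P>. signed_integral M \<mu> (rep a))
       (ca_c M \<P>) (order_continuous_dual M \<P>)"


section \<open>Adequacy of the choice of index type\<close>

lemma Linf_le_refl: "a \<in> Linf M \<P> \<Longrightarrow> Linf_le \<P> a a"
  unfolding Linf_def Linf_le_def quotient_def qs_rel_def qs_def by auto

lemma Linf_le_trans:
  assumes b: "b \<in> Linf M \<P>" and "Linf_le \<P> a b" "Linf_le \<P> b d"
  shows "Linf_le \<P> a d"
proof -
  obtain X Y where 1: "X \<in> a" "Y \<in> b" "qs \<P> (\<lambda>\<omega>. X \<omega> \<le> Y \<omega>)"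
    using assms(2) unfolding Linf_le_def by blast
  obtain Y' Z where 2: "Y' \<in> b" "Z \<in> d" "qs \<P> (\<lambda>\<omega>. Y' \<omega> \<le> Z \<omega>)"
    using assms(3) unfolding Linf_le_def by blast
  obtain W where W: "b = qs_rel M \<P> `` {W}"
    using b unfolding Linf_def quotient_def by blast
  have 3: "qs \<P> (\<lambda>\<omega>. W \<omega> = Y \<omega>)" "qs \<P> (\<lambda>\<omega>. W \<omega> = Y' \<omega>)"
    using 1(2) 2(1) W unfolding qs_rel_def by auto
  have "qs \<P> (\<lambda>\<omega>. X \<omega> \<le> Z \<omega>)"
    unfolding qs_def
  proof
    fix P assume "P \<in> \<P>"
    then have "AE \<omega> in P. X \<omega> \<le> Y \<omega>" "AE \<omega> in P. Y' \<omega> \<le> Z \<omega>"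
      "AE \<omega> in P. W \<omega> = Y \<omega>" "AE \<omega> in P. W \<omega> = Y' \<omega>"
      using 1(3) 2(3) 3 unfolding qs_def by auto
    then show "AE \<omega> in P. X \<omega> \<le> Z \<omega>" by eventually_elim simp
  qed
  then show ?thesis using 1(1) 2(2) unfolding Linf_le_def by blast
qed

lemma order_continuous_all_nets:
  fixes I :: "'i set" and X :: "'i \<Rightarrow> ('a \<Rightarrow> real) set"
  assumes l: "order_continuous M \<P> l" and dir: "directed_set I r"
    and X: "\<forall>i\<in>I. X i \<in> Linf M \<P>" and conv: "order_converges_zero M \<P> I r X"
  shows "net_null I r (\<lambda>i. l (X i))"
proof (rule ccontr)
  assume "\<not> net_null I r (\<lambda>i. l (X i))"
  then obtain \<epsilon> where \<epsilon>: "\<epsilon> > 0" and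
    frequent: "\<And>i. i \<in> I \<Longrightarrow> \<exists>j\<in>I. r i j \<and> \<not> \<bar>l (X j)\<bar> < \<epsilon>"
    unfolding net_null_def by blast
  obtain Y where Y: "\<And>i. i \<in> I \<Longrightarrow> Y i \<in> Linf M \<P>"
    and dec: "\<And>i j. i \<in> I \<Longrightarrow> j \<in> I \<Longrightarrow> r i j \<Longrightarrow> Linf_le \<P> (Y j) (Y i)"
    and inf: "is_infimum M \<P> (Y ` I) (cls M \<P> (\<lambda>_. 0))"
    and dom: "\<And>i. i \<in> I \<Longrightarrow> Linf_le \<P> (Linf_abs M \<P> (X i)) (Y i)"
    using conv unfolding order_converges_zero_def by blast
  define I' where "I' = {i \<in> I. \<not> \<bar>l (X i)\<bar> < \<epsilon>}"
  define J where "J = Y ` I'"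
  define s where "s = (\<lambda>y y'. Linf_le \<P> y' y)"
  define k where "k = (\<lambda>y. SOME i. i \<in> I' \<and> Y i = y)"
  have k: "k y \<in> I'" "Y (k y) = y" if "y \<in> J" for y
    using someI_ex[of "\<lambda>i. i \<in> I' \<and> Y i = y"] that unfolding J_def k_def by auto
  have I'I: "I' \<subseteq> I" unfolding I'_def by blast
  have JL: "J \<subseteq> Linf M \<P>" unfolding J_def using Y I'I by blast
  have below: "\<exists>j\<in>I'. r i j \<and> Linf_le \<P> (Y j) (Y i)" if "i \<in> I" for i
    using frequent[OF that] dec that unfolding I'_def by blast
  have dirJ: "directed_set J s"
    unfolding directed_set_def
  proof (intro conjI ballI impI)
    show "J \<noteq> {}" using below dir unfolding J_def directed_set_def by blast
    show "s y y" if "y \<in> J" for y using that JL Linf_le_refl unfolding s_def by blast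
    show "s x z" if "x \<in> J" "y \<in> J" "z \<in> J" "s x y" "s y z" for x y z
      using that JL Linf_le_trans unfolding s_def by blast
    show "\<exists>z\<in>J. s x z \<and> s y z" if xy: "x \<in> J" "y \<in> J" for x y
    proof -
      obtain m where m: "m \<in> I" "r (k x) m" "r (k y) m"
        using dir k(1)[OF xy(1)] k(1)[OF xy(2)] I'I unfolding directed_set_def by blast
      obtain j where j: "j \<in> I'" "Linf_le \<P> (Y j) (Y m)" using below m(1) by blast
      have "Linf_le \<P> (Y m) x" "Linf_le \<P> (Y m) y"
        using dec[of "k x" m] dec[of "k y" m] m k[OF xy(1)] k[OF xy(2)] I'I by auto
      then have "s x (Y j)" "s y (Y j)"
        using Linf_le_trans[OF Y[OF m(1)] j(2)] unfolding s_def by auto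
      then show ?thesis using j(1) unfolding J_def by blast
    qed
  qed
  have infJ: "is_infimum M \<P> (id ` J) (cls M \<P> (\<lambda>_. 0))"
    unfolding is_infimum_def
  proof (intro conjI ballI impI)
    show "cls M \<P> (\<lambda>_. 0) \<in> Linf M \<P>" using inf unfolding is_infimum_def by blast
    show "Linf_le \<P> (cls M \<P> (\<lambda>_. 0)) y" if "y \<in> id ` J" for y
      using inf that I'I unfolding is_infimum_def J_def by auto
    show "Linf_le \<P> u (cls M \<P> (\<lambda>_. 0))"
      if u: "u \<in> Linf M \<P>" "\<forall>y\<in>id ` J. Linf_le \<P> u y" for u
    proof -
      have "Linf_le \<P> u (Y i)" if "i \<in> I" for i
      proof -
        obtain j where j: "j \<in> I'" "Linf_le \<P> (Y j) (Y i)" using below \<open>i \<in> I\<close> by blast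
        have "Linf_le \<P> u (Y j)" using u(2) j(1) unfolding J_def by auto
        then show ?thesis using Linf_le_trans[OF Y _ j(2)] j(1) I'I by blast
      qed
      then show ?thesis using inf u(1) unfolding is_infimum_def by blast
    qed
  qed
  have "order_converges_zero M \<P> J s (\<lambda>y. X (k y))"
    unfolding order_converges_zero_def
  proof (intro exI[of _ id] conjI ballI impI)
    show "Linf_le \<P> (Linf_abs M \<P> (X (k y))) (id y)" if "y \<in> J" for y
      using dom[of "k y"] k[OF that] I'I by auto
  qed (use JL infJ in \<open>auto simp: s_def\<close>)
  moreover have "\<forall>y\<in>J. X (k y) \<in> Linf M \<P>" using X k(1) I'I by blast
  ultimately have "net_null J s (\<lambda>y. l (X (k y)))"
    using l[unfolded order_continuous_def, rule_format, of J s "\<lambda>y. X (k y)"] dirJ by blast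
  then obtain y where "y \<in> J" "\<forall>z\<in>J. s y z \<longrightarrow> \<bar>l (X (k z))\<bar> < \<epsilon>"
    using \<epsilon> unfolding net_null_def by blast
  moreover have "s y y" using \<open>y \<in> J\<close> dirJ unfolding directed_set_def by blast
  ultimately show False using k(1)[of y] unfolding I'_def by blast
qed

end

theory Submission
  imports Defs
begin

text \<open>
  If \<open>ca\<^sub>c\<^sup>* = L\<^sup>\<infinity>\<^sub>c\<close> and \<open>\<D>\<close> is norm bounded, then
  \<open>\<phi>(\<mu>) = lim \<integral> max F d\<mu>\<close>, the limit over the finite subsets \<open>F\<close> of \<open>\<D>\<close>, is a bounded linear
  functional on \<open>ca\<^sub>c\<close>, and the element of \<open>L\<^sup>\<infinity>\<^sub>c\<close> representing it is the supremum of \<open>\<D>\<close>.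

  Conversely, let \<open>\<phi>\<close> be a functional on \<open>ca\<^sub>c\<close> of norm at most \<open>K\<close>. Its representative is the supremum
  \<open>s\<close> of all \<open>X \<ge> -K\<close> with \<open>\<integral> X d\<nu> \<le> \<phi>(\<nu>)\<close> for every positive \<open>\<nu> \<in> ca\<^sub>c\<close>. Indeed, since integration
  against a positive \<open>\<mu> \<in> ca\<^sub>c\<close> is order continuous, \<open>\<mu>\<close> has a support: an event \<open>S\<close> of full
  \<open>\<mu>\<close>-measure all of whose \<open>\<mu>\<close>-null subsets are polar. On \<open>S\<close> every positive \<open>\<nu> \<in> ca\<^sub>c\<close> has a density
  with respect to \<open>\<mu>\<close>, so there \<open>\<phi>\<close> is given by a single bounded function \<open>Z\<close>. The function equal
  to \<open>Z\<close> on \<open>S\<close> and to \<open>-K\<close> off \<open>S\<close> is one of the \<open>X\<close>, and with \<open>K\<close> in place of \<open>-K\<close> one gets an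
  upper bound of them; hence \<open>s = Z\<close> on \<open>S\<close> and \<open>\<integral> s d\<mu> = \<phi>(\<mu>)\<close>.
\<close>

section \<open>Hahn and Jordan decomposition\<close>

text \<open>The constant sequence \<open>{}\<close> is disjoint with union \<open>{}\<close>, so the
  series with constant term \<open>\<mu> {}\<close> converges, which forces the term to be
  0.\<close>

lemma ca_empty: "\<mu> \<in> ca M \<Longrightarrow> \<mu> {} = 0"
proof -
  assume "\<mu> \<in> ca M"
  then have "(\<lambda>n::nat. \<mu> {}) sums \<mu> (\<Union>n::nat. {})"
    unfolding ca_def by (auto simp: disjoint_family_on_def dest!: spec[of _ "\<lambda>_. {}"])
  then have "summable (\<lambda>n::nat. \<mu> {})" by (rule sums_summable)
  then show ?thesis using summable_LIMSEQ_zero LIMSEQ_const_iff by blast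
qed

lemma ca_sums:
  assumes "\<mu> \<in> ca M" "range A \<subseteq> sets M" "disjoint_family A"
  shows "(\<lambda>n::nat. \<mu> (A n)) sums \<mu> (\<Union>n. A n)"
  using assms unfolding ca_def by auto

lemma ca_Un:
  assumes "\<mu> \<in> ca M" "A \<in> sets M" "B \<in> sets M" "A \<inter> B = {}"
  shows "\<mu> (A \<union> B) = \<mu> A + \<mu> B"
proof -
  have "(\<lambda>n. \<mu> (binaryset A B n)) sums \<mu> (\<Union>n. binaryset A B n)"
    using assms by (intro ca_sums[OF assms(1)])
      (auto simp: range_binaryset_eq disjoint_family_on_def binaryset_def)
  moreover have "(\<lambda>n. \<mu> (binaryset A B n)) sums (\<mu> A + \<mu> B)"
    by (rule binaryset_sums) (rule ca_empty[OF assms(1)])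
  ultimately show ?thesis unfolding UN_binaryset_eq by (rule sums_unique2)
qed

lemma ca_Diff:
  assumes "\<mu> \<in> ca M" "A \<in> sets M" "B \<in> sets M" "B \<subseteq> A"
  shows "\<mu> (A - B) = \<mu> A - \<mu> B"
  using ca_Un[of \<mu> M "A - B" B] assms by (simp add: Un_absorb2 sets.Diff Int_commute[of _ B])

lemma ca_split:
  assumes "\<mu> \<in> ca M" "A \<in> sets M" "H \<in> sets M"
  shows "\<mu> A = \<mu> (A \<inter> H) + \<mu> (A - H)"
  using ca_Un[of \<mu> M "A \<inter> H" "A - H"] assms by (auto simp: Int_Diff_Un)

lemma ca_uminus: "\<mu> \<in> ca M \<Longrightarrow> (\<lambda>A. - \<mu> A) \<in> ca M"
  unfolding ca_def by (auto intro!: sums_minus)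

lemma ca_add: "\<mu> \<in> ca M \<Longrightarrow> \<nu> \<in> ca M \<Longrightarrow> (\<lambda>A. \<mu> A + \<nu> A) \<in> ca M"
  unfolding ca_def by (auto intro!: sums_add)

lemma ca_scale: "\<mu> \<in> ca M \<Longrightarrow> (\<lambda>A. r * \<mu> A) \<in> ca M"
  unfolding ca_def by (auto intro!: sums_mult)

section \<open>Exhaustion and the Hahn decomposition\<close>

definition negative_set :: "'a measure \<Rightarrow> ('a set \<Rightarrow> real) \<Rightarrow> 'a set \<Rightarrow> bool" where
  "negative_set M \<mu> N \<longleftrightarrow> N \<in> sets M \<and> (\<forall>B\<in>sets M. B \<subseteq> N \<longrightarrow> \<mu> B \<le> 0)"

text \<open>The greedy choice for the exhaustion. A subset of measure at least 1 serves if there is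
  one; otherwise the supremum over subsets is finite, and either some subset exceeds half of it or
  it is at most 0 and \<open>{}\<close> serves. The cap at 1 is there because finiteness of that
  supremum is not yet known.\<close>

lemma almost_maximal_subset:
  assumes "\<mu> \<in> ca M" "A \<in> sets M"
  shows "\<exists>B\<in>sets M. B \<subseteq> A \<and> 0 \<le> \<mu> B \<and> (\<forall>C\<in>sets M. C \<subseteq> A \<longrightarrow> min 1 (\<mu> C / 2) \<le> \<mu> B)"
proof (cases "\<exists>B\<in>sets M. B \<subseteq> A \<and> 1 \<le> \<mu> B")
  case True
  then obtain B where "B \<in> sets M" "B \<subseteq> A" "1 \<le> \<mu> B" by blast
  then show ?thesis by (intro bexI[of _ B]) auto
next
  case False
  define S where "S = \<mu> ` {C\<in>sets M. C \<subseteq> A}"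
  have bdd: "bdd_above S" using False unfolding S_def by (intro bdd_aboveI[of _ 1]) auto
  have up: "\<mu> C \<le> Sup S" if "C \<in> sets M" "C \<subseteq> A" for C
    using that bdd unfolding S_def by (intro cSup_upper) auto
  show ?thesis
  proof (cases "Sup S \<le> 0")
    case True
    have "min 1 (\<mu> C / 2) \<le> \<mu> {}" if "C \<in> sets M" "C \<subseteq> A" for C
      using up[OF that] True ca_empty[OF assms(1)] by auto
    then show ?thesis using ca_empty[OF assms(1)] by (intro bexI[of _ "{}"]) auto
  next
    case False
    then have "Sup S / 2 < Sup S" by simp
    then obtain B where B: "B \<in> sets M" "B \<subseteq> A" "Sup S / 2 < \<mu> B"
      using less_cSup_iff[of S "Sup S / 2"] bdd assms(2) unfolding S_def by blast
    have "min 1 (\<mu> C / 2) \<le> \<mu> B" if "C \<in> sets M" "C \<subseteq> A" for C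
      using up[OF that] B(3) by auto
    then show ?thesis using B False by (intro bexI[of _ B]) auto
  qed
qed

text \<open>Doss's argument: remove almost maximal subsets repeatedly; the removed measures are summable,
  so nothing of positive measure survives.\<close>

lemma negative_subset:
  assumes \<mu>: "\<mu> \<in> ca M" and D: "D \<in> sets M"
  shows "\<exists>N. N \<subseteq> D \<and> negative_set M \<mu> N \<and> \<mu> N \<le> \<mu> D"
proof -
  obtain b where b: "\<And>A. A \<in> sets M \<Longrightarrow> b A \<in> sets M" "\<And>A. A \<in> sets M \<Longrightarrow> b A \<subseteq> A"
    "\<And>A. A \<in> sets M \<Longrightarrow> 0 \<le> \<mu> (b A)"
    "\<And>A C. A \<in> sets M \<Longrightarrow> C \<in> sets M \<Longrightarrow> C \<subseteq> A \<Longrightarrow> min 1 (\<mu> C / 2) \<le> \<mu> (b A)"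
    using almost_maximal_subset[OF \<mu>] by metis
  \<comment> \<open>The remainder after \<open>n\<close> removals. The removed pieces
    \<open>b (A n)\<close> turn out to be disjoint, so their measures form a convergent
    series.\<close>
  define A where "A n = ((\<lambda>a. a - b a) ^^ n) D" for n :: nat
  have A_Suc: "A (Suc n) = A n - b (A n)" for n unfolding A_def by simp
  have A_sets: "A n \<in> sets M" for n
    by (induction n) (auto simp: A_Suc b D, simp add: A_def D)
  have "A (Suc n) \<subseteq> A n" for n using A_Suc by blast
  then have anti: "A m \<subseteq> A n" if "n \<le> m" for n m
    using lift_Suc_antimono_le[of A] that by blast
  define U where "U = (\<Union>n. b (A n))"
  have disj: "b (A n) \<inter> b (A m) = {}" if "n < m" for n m
    using b(2)[OF A_sets[of m]] anti[of "Suc n" m] that A_Suc[of n] by auto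
  have "disjoint_family (\<lambda>n. b (A n))"
    unfolding disjoint_family_on_def
    by (metis (no_types, lifting) disj inf_commute nat_neq_iff)
  then have sums: "(\<lambda>n. \<mu> (b (A n))) sums \<mu> U"
    unfolding U_def using b(1) A_sets by (intro ca_sums[OF \<mu>]) auto
  have U: "U \<in> sets M" unfolding U_def using b(1) A_sets by auto
  have "A 0 = D" unfolding A_def by simp
  then have "U \<subseteq> D" unfolding U_def using b(2)[OF A_sets] anti[of 0] by blast
  have DU: "D - U \<subseteq> A n" for n
    by (induction n) (auto simp: A_Suc U_def \<open>A 0 = D\<close>)
  have "0 \<le> \<mu> U" using sums b(3)[OF A_sets] by (metis sums_unique suminf_nonneg sums_summable)
  then have "\<mu> (D - U) \<le> \<mu> D" using ca_Diff[OF \<mu> D U \<open>U \<subseteq> D\<close>] by simp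
  moreover have "\<mu> C \<le> 0" if C: "C \<in> sets M" "C \<subseteq> D - U" for C
  proof -
    \<comment> \<open>The terms of the convergent series tend to 0. Since \<open>C\<close> survives
      every removal, it was a candidate at each stage, so \<open>min 1 (\<mu> C / 2)\<close> lies
      below every term.\<close>
    have "(\<lambda>n. \<mu> (b (A n))) \<longlonglongrightarrow> 0" using sums by (intro summable_LIMSEQ_zero sums_summable)
    then have "min 1 (\<mu> C / 2) \<le> 0"
      using b(4)[OF A_sets C(1)] C(2) DU by (intro LIMSEQ_le_const) blast+
    then show ?thesis by auto
  qed
  ultimately show ?thesis using D U unfolding negative_set_def by (intro exI[of _ "D - U"]) auto
qed

text \<open>\<open>disjointed\<close> cuts a subset of the union into disjoint pieces, each inside
  one \<open>N n\<close>; all terms of the resulting series are nonpositive.\<close>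

lemma negative_set_UN:
  assumes \<mu>: "\<mu> \<in> ca M" and N: "\<And>n::nat. negative_set M \<mu> (N n)"
  shows "negative_set M \<mu> (\<Union>n. N n)"
  unfolding negative_set_def
proof (intro conjI ballI impI)
  show "(\<Union>n. N n) \<in> sets M" using N unfolding negative_set_def by auto
  fix B assume B: "B \<in> sets M" "B \<subseteq> (\<Union>n. N n)"
  have dN: "disjointed N n \<in> sets M" for n
    using N sets.range_disjointed_sets[of N M] unfolding negative_set_def by auto
  have "(\<lambda>n. \<mu> (B \<inter> disjointed N n)) sums \<mu> (\<Union>n. B \<inter> disjointed N n)"
    using B dN disjoint_family_disjointed[of N]
    by (intro ca_sums[OF \<mu>]) (auto simp: disjoint_family_on_def, blast)
  moreover have "(\<Union>n. B \<inter> disjointed N n) = B"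
    using B(2) UN_disjointed_eq[of N] by blast
  moreover have "\<mu> (B \<inter> disjointed N n) \<le> 0" for n
    using N[of n] B dN[of n] disjointed_subset[of N n] unfolding negative_set_def by blast
  ultimately show "\<mu> B \<le> 0" using sums_le[OF _ _ sums_zero] by metis
qed

text \<open>The infimum of \<open>\<mu>\<close> over the negative sets is finite and attained by a
  countable union \<open>V\<close>. A set of negative measure off \<open>V\<close> would contain a
  negative set that, added to \<open>V\<close>, undercuts the infimum; so the complement of
  \<open>V\<close> serves as \<open>H\<close>.\<close>

theorem Hahn_decomposition:
  assumes \<mu>: "\<mu> \<in> ca M"
  shows "\<exists>H\<in>sets M. (\<forall>B\<in>sets M. B \<subseteq> H \<longrightarrow> 0 \<le> \<mu> B) \<and>
    (\<forall>B\<in>sets M. B \<subseteq> space M - H \<longrightarrow> \<mu> B \<le> 0)"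
proof -
  define S where "S = \<mu> ` Collect (negative_set M \<mu>)"
  have mono: "\<mu> N' \<le> \<mu> N" if "negative_set M \<mu> N'" "negative_set M \<mu> N" "N \<subseteq> N'" for N N'
  proof -
    have "\<mu> (N' - N) \<le> 0" using that unfolding negative_set_def by auto
    then show ?thesis using ca_Diff[OF \<mu> _ _ that(3)] that unfolding negative_set_def by auto
  qed
  have "negative_set M \<mu> {}" unfolding negative_set_def using ca_empty[OF \<mu>] by auto
  then have "S \<noteq> {}" unfolding S_def by blast
  \<comment> \<open>Otherwise the union of negative sets with measures below \<open>- n\<close>, one
    for each \<open>n\<close>, would have a real measure below every \<open>- n\<close>.\<close>
  have bdd: "bdd_below S"
  proof (rule ccontr)
    assume "\<not> bdd_below S"
    then have "\<exists>N. negative_set M \<mu> N \<and> \<mu> N < - real n" for n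
      unfolding bdd_below_def S_def by (metis (no_types, lifting) imageE mem_Collect_eq not_le)
    then obtain N where N: "\<And>n. negative_set M \<mu> (N n)" "\<And>n. \<mu> (N n) < - real n" by metis
    have "\<mu> (\<Union>n. N n) < - real n" for n
      using mono[OF negative_set_UN[OF \<mu> N(1)] N(1)[of n]] N(2)[of n] by fastforce
    moreover obtain n where "- \<mu> (\<Union>n. N n) < real n" using reals_Archimedean2 by blast
    ultimately show False by (metis less_asym minus_less_iff)
  qed
  have "\<exists>N. negative_set M \<mu> N \<and> \<mu> N < Inf S + inverse (real (Suc n))" for n
    using cInf_lessD[OF \<open>S \<noteq> {}\<close>, of "Inf S + inverse (real (Suc n))"] unfolding S_def by auto
  then obtain N where N: "\<And>n. negative_set M \<mu> (N n)"
    "\<And>n. \<mu> (N n) < Inf S + inverse (real (Suc n))" by metis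
  define V where "V = (\<Union>n. N n)"
  have V: "negative_set M \<mu> V" unfolding V_def by (rule negative_set_UN[OF \<mu> N(1)])
  have "\<mu> V \<le> Inf S + inverse (real (Suc n))" for n
    using mono[OF V N(1)[of n]] N(2)[of n] unfolding V_def by fastforce
  then have "\<mu> V - Inf S \<le> inverse (real (Suc n))" for n by (simp add: algebra_simps)
  then have "\<mu> V \<le> Inf S" using reals_Archimedean[of "\<mu> V - Inf S"] by (meson diff_gt_0_iff_gt not_le)
  have VM: "V \<in> sets M" using V unfolding negative_set_def by blast
  have "0 \<le> \<mu> B" if B: "B \<in> sets M" "B \<subseteq> space M - V" for B
  proof (rule ccontr)
    assume "\<not> 0 \<le> \<mu> B"
    obtain A where A: "A \<subseteq> B" "negative_set M \<mu> A" "\<mu> A \<le> \<mu> B"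
      using negative_subset[OF \<mu> B(1)] by blast
    have "negative_set M \<mu> (\<Union>n. if n = (0::nat) then V else A)"
      using V A(2) by (intro negative_set_UN[OF \<mu>]) auto
    moreover have "(\<Union>n. if n = (0::nat) then V else A) = V \<union> A" by (auto split: if_splits)
    ultimately have "Inf S \<le> \<mu> (V \<union> A)"
      using bdd unfolding S_def by (intro cInf_lower) auto
    also have "\<dots> = \<mu> V + \<mu> A"
      using A V B unfolding negative_set_def by (intro ca_Un[OF \<mu>]) auto
    finally show False using \<open>\<mu> V \<le> Inf S\<close> A(3) \<open>\<not> 0 \<le> \<mu> B\<close> by simp
  qed
  moreover have "space M - (space M - V) = V" using sets.sets_into_space[OF VM] by blast
  ultimately show ?thesis
    using V unfolding negative_set_def by (intro bexI[of _ "space M - V"]) auto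
qed

section \<open>Jordan decomposition and the total variation norm\<close>

lemma space_pos_part [simp]: "space (pos_part M \<mu>) = space M"
  unfolding pos_part_def by (simp add: sets.space_closed space_measure_of)

lemma sets_pos_part [simp, measurable_cong]: "sets (pos_part M \<mu>) = sets M"
  unfolding pos_part_def by (rule sets.sets_measure_of_eq)

text \<open>The supremum defining the positive part is attained at \<open>A \<inter> H\<close>:
  discarding \<open>B - H\<close> from \<open>B\<close> and then adding the rest of
  \<open>A \<inter> H\<close> never decreases \<open>\<mu>\<close>. The resulting formula is
  countably additive, so \<open>measure_of\<close> takes the prescribed values.\<close>

lemma emeasure_pos_part:
  assumes \<mu>: "\<mu> \<in> ca M" and H: "H \<in> sets M" "\<And>B. B \<in> sets M \<Longrightarrow> B \<subseteq> H \<Longrightarrow> 0 \<le> \<mu> B"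
    "\<And>B. B \<in> sets M \<Longrightarrow> B \<subseteq> space M - H \<Longrightarrow> \<mu> B \<le> 0" and A: "A \<in> sets M"
  shows "emeasure (pos_part M \<mu>) A = ennreal (\<mu> (A \<inter> H))"
proof -
  have sup: "(SUP B\<in>{B\<in>sets M. B \<subseteq> A}. \<mu> B) = \<mu> (A \<inter> H)" if A: "A \<in> sets M" for A
  proof (rule cSup_eq_maximum)
    show "\<mu> (A \<inter> H) \<in> \<mu> ` {B \<in> sets M. B \<subseteq> A}" using A H(1) by auto
    fix x assume "x \<in> \<mu> ` {B \<in> sets M. B \<subseteq> A}"
    then obtain B where B: "x = \<mu> B" "B \<in> sets M" "B \<subseteq> A" by blast
    have "\<mu> (B - H) \<le> 0"
      using B H(1) sets.sets_into_space[OF B(2)] by (intro H(3)) auto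
    moreover have "0 \<le> \<mu> (A \<inter> H - B \<inter> H)" using A B H(1) by (intro H(2)) auto
    moreover have "\<mu> (A \<inter> H - B \<inter> H) = \<mu> (A \<inter> H) - \<mu> (B \<inter> H)"
      using A B H(1) by (intro ca_Diff[OF \<mu>]) auto
    ultimately show "x \<le> \<mu> (A \<inter> H)" using ca_split[OF \<mu> B(2) H(1)] B(1) by simp
  qed
  have *: "emeasure (pos_part M \<mu>) A = ennreal (SUP B\<in>{B\<in>sets M. B \<subseteq> A}. \<mu> B)"
    unfolding pos_part_def
  proof (rule emeasure_measure_of_sigma[OF sets.sigma_algebra_axioms _ _ A])
    show "positive (sets M) (\<lambda>A. ennreal (SUP B\<in>{B\<in>sets M. B \<subseteq> A}. \<mu> B))"
      unfolding positive_def by (simp add: sup ca_empty[OF \<mu>])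
    show "countably_additive (sets M) (\<lambda>A. ennreal (SUP B\<in>{B\<in>sets M. B \<subseteq> A}. \<mu> B))"
      unfolding countably_additive_def
    proof (intro allI impI)
      fix F :: "nat \<Rightarrow> 'a set"
      assume F: "range F \<subseteq> sets M" "disjoint_family F" "\<Union> (range F) \<in> sets M"
      have "(\<lambda>n. \<mu> (F n \<inter> H)) sums \<mu> (\<Union>n. F n \<inter> H)"
        using F H(1) by (intro ca_sums[OF \<mu>]) (auto simp: disjoint_family_on_def)
      then have "(\<lambda>n. ennreal (\<mu> (F n \<inter> H))) sums ennreal (\<mu> (\<Union>n. F n \<inter> H))"
        using F H(1) by (subst sums_ennreal) (auto intro!: H(2))
      then show "(\<Sum>i. ennreal (SUP B\<in>{B \<in> sets M. B \<subseteq> F i}. \<mu> B)) =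
          ennreal (SUP B\<in>{B \<in> sets M. B \<subseteq> \<Union> (range F)}. \<mu> B)"
        using F by (subst sup[OF F(3)]) (auto simp: sup range_subsetD sums_iff)
    qed
  qed
  then show ?thesis using sup[OF A] by simp
qed

text \<open>One Hahn set serves both parts: its complement is positive for \<open>- \<mu>\<close>,
  so the formula for the positive part applies to \<open>- \<mu>\<close> with
  \<open>space M - H\<close>.\<close>

lemma Jordan_decomposition:
  assumes \<mu>: "\<mu> \<in> ca M"
  obtains H where "H \<in> sets M"
    "\<And>A. A \<in> sets M \<Longrightarrow> measure (pos_part M \<mu>) A = \<mu> (A \<inter> H)"
    "\<And>A. A \<in> sets M \<Longrightarrow> measure (pos_part M (\<lambda>A. - \<mu> A)) A = - \<mu> (A - H)"
    "finite_measure (pos_part M \<mu>)" "finite_measure (pos_part M (\<lambda>A. - \<mu> A))"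
proof -
  obtain H where H: "H \<in> sets M" "\<And>B. B \<in> sets M \<Longrightarrow> B \<subseteq> H \<Longrightarrow> 0 \<le> \<mu> B"
    "\<And>B. B \<in> sets M \<Longrightarrow> B \<subseteq> space M - H \<Longrightarrow> \<mu> B \<le> 0"
    using Hahn_decomposition[OF \<mu>] by (elim bexE conjE) simp
  have HH: "space M - (space M - H) = H" using sets.sets_into_space[OF H(1)] by blast
  have p: "emeasure (pos_part M \<mu>) A = ennreal (\<mu> (A \<inter> H))" if "A \<in> sets M" for A
    by (rule emeasure_pos_part[OF \<mu> H that])
  have q: "emeasure (pos_part M (\<lambda>A. - \<mu> A)) A = ennreal (- \<mu> (A - H))" if "A \<in> sets M" for A
  proof -
    have "emeasure (pos_part M (\<lambda>A. - \<mu> A)) A = ennreal (- \<mu> (A \<inter> (space M - H)))"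
      using H by (intro emeasure_pos_part[OF ca_uminus[OF \<mu>] _ _ _ that]) (auto simp: HH)
    moreover have "A \<inter> (space M - H) = A - H" using sets.sets_into_space[OF that] by blast
    ultimately show ?thesis by simp
  qed
  show thesis
  proof (rule that[OF H(1)])
    show "measure (pos_part M \<mu>) A = \<mu> (A \<inter> H)" if "A \<in> sets M" for A
      using p[OF that] H that unfolding measure_def by (simp add: H(2))
    show "measure (pos_part M (\<lambda>A. - \<mu> A)) A = - \<mu> (A - H)" if "A \<in> sets M" for A
    proof -
      have "\<mu> (A - H) \<le> 0"
        using H(1) that sets.sets_into_space[OF that] by (intro H(3)) auto
      then show ?thesis using q[OF that] unfolding measure_def by simp
    qed
  qed (auto intro!: finite_measureI simp: p q)
qed

lemma ca_eq_diff:
  assumes "\<mu> \<in> ca M" "A \<in> sets M"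
  shows "\<mu> A = measure (pos_part M \<mu>) A - measure (pos_part M (\<lambda>A. - \<mu> A)) A"
proof (rule Jordan_decomposition[OF assms(1)])
  fix H assume "H \<in> sets M"
    "\<And>A. A \<in> sets M \<Longrightarrow> measure (pos_part M \<mu>) A = \<mu> (A \<inter> H)"
    "\<And>A. A \<in> sets M \<Longrightarrow> measure (pos_part M (\<lambda>A. - \<mu> A)) A = - \<mu> (A - H)"
  then show ?thesis using ca_split[OF assms, of H] assms(2) by simp
qed

lemma finite_pos_part:
  assumes "\<mu> \<in> ca M"
  shows "finite_measure (pos_part M \<mu>)" "finite_measure (pos_part M (\<lambda>A. - \<mu> A))"
  by (rule Jordan_decomposition[OF assms], assumption)+

text \<open>The Hahn partition attains the supremum, and for any partition
  \<open>\<bar>\<mu> A\<bar>\<close> is at most the sum of the two Jordan parts at \<open>A\<close>,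
  which add up to the total masses.\<close>

lemma tv_norm_eq:
  assumes \<mu>: "\<mu> \<in> ca M"
  shows "tv_norm M \<mu> =
    measure (pos_part M \<mu>) (space M) + measure (pos_part M (\<lambda>A. - \<mu> A)) (space M)"
    (is "_ = measure ?p _ + measure ?q _")
proof -
  interpret p: finite_measure ?p by (rule finite_pos_part(1)[OF \<mu>])
  interpret q: finite_measure ?q by (rule finite_pos_part(2)[OF \<mu>])
  obtain H where H: "H \<in> sets M"
    "\<And>A. A \<in> sets M \<Longrightarrow> measure ?p A = \<mu> (A \<inter> H)"
    "\<And>A. A \<in> sets M \<Longrightarrow> measure ?q A = - \<mu> (A - H)"
    by (rule Jordan_decomposition[OF \<mu>]) blast
  show ?thesis
    unfolding tv_norm_def
  proof (rule cSup_eq_maximum)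
    \<comment> \<open>\<open>partition_on\<close> forbids empty blocks, so \<open>{}\<close> is
      removed in case \<open>H\<close> or its complement is empty; the sum does not change.\<close>
    let ?A = "{H, space M - H} - {{}}"
    have HM: "H \<subseteq> space M" using sets.sets_into_space[OF H(1)] .
    have "(\<Sum>A\<in>?A. \<bar>\<mu> A\<bar>) = (\<Sum>A\<in>{H, space M - H}. \<bar>\<mu> A\<bar>)"
      by (intro sum.mono_neutral_left) (auto simp: ca_empty[OF \<mu>])
    also have "\<dots> = \<bar>\<mu> H\<bar> + \<bar>\<mu> (space M - H)\<bar>"
    proof (cases "H = space M - H")
      case True
      then have "space M = {}" "H = {}" using HM by auto
      then show ?thesis by (simp add: ca_empty[OF \<mu>])
    qed simp
    also have "\<dots> = measure ?p (space M) + measure ?q (space M)"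
    proof -
      have "space M \<inter> H = H" using HM by blast
      then show ?thesis using H(2)[of "space M"] H(3)[of "space M"]
        by (metis abs_minus_cancel abs_of_nonneg measure_nonneg sets.top)
    qed
    finally have *: "(\<Sum>A\<in>?A. \<bar>\<mu> A\<bar>) = measure ?p (space M) + measure ?q (space M)" .
    show "measure ?p (space M) + measure ?q (space M) \<in> (\<lambda>\<A>. \<Sum>A\<in>\<A>. \<bar>\<mu> A\<bar>) `
        {\<A>. finite \<A> \<and> \<A> \<subseteq> sets M \<and> partition_on (space M) \<A>}"
      using H(1) HM by (intro image_eqI[where x = "?A"] *[symmetric])
        (auto simp: partition_on_def disjoint_def)
    fix x assume "x \<in> (\<lambda>\<A>. \<Sum>A\<in>\<A>. \<bar>\<mu> A\<bar>) `
        {\<A>. finite \<A> \<and> \<A> \<subseteq> sets M \<and> partition_on (space M) \<A>}"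
    then obtain \<A> where \<A>: "x = (\<Sum>A\<in>\<A>. \<bar>\<mu> A\<bar>)" "finite \<A>" "\<A> \<subseteq> sets M"
      "partition_on (space M) \<A>" by blast
    have U: "\<Union>\<A> = space M" and dis: "disjoint_family_on (\<lambda>A. A) \<A>"
      using \<A>(4) unfolding partition_on_def disjoint_def disjoint_family_on_def by auto
    have "x \<le> (\<Sum>A\<in>\<A>. measure ?p A + measure ?q A)"
      unfolding \<A>(1)
    proof (rule sum_mono)
      fix A assume "A \<in> \<A>"
      then show "\<bar>\<mu> A\<bar> \<le> measure ?p A + measure ?q A"
        using ca_eq_diff[OF \<mu>, of A] \<A>(3) measure_nonneg[of ?p A] measure_nonneg[of ?q A]
        by (auto simp: abs_if)
    qed
    also have "\<dots> = measure ?p (\<Union>A\<in>\<A>. A) + measure ?q (\<Union>A\<in>\<A>. A)"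
      unfolding sum.distrib using \<A>(2,3) dis
      by (subst (1 2) measure_finite_Union) auto
    finally show "x \<le> measure ?p (space M) + measure ?q (space M)" using U by simp
  qed
qed

section \<open>The integral against a signed measure\<close>

lemma bdd_measurableD:
  assumes "X \<in> bdd_measurable M"
  obtains C where "X \<in> borel_measurable M" "0 \<le> C" "\<And>\<omega>. \<omega> \<in> space M \<Longrightarrow> \<bar>X \<omega>\<bar> \<le> C"
proof -
  from assms obtain C where "\<forall>x\<in>X ` space M. norm x \<le> C"
    unfolding bdd_measurable_def bounded_iff by blast
  then show ?thesis
    using assms that[of "max 0 C"] unfolding bdd_measurable_def by fastforce
qed

lemma bdd_measurableI:
  assumes "X \<in> borel_measurable M" "\<And>\<omega>. \<omega> \<in> space M \<Longrightarrow> \<bar>X \<omega>\<bar> \<le> C"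
  shows "X \<in> bdd_measurable M"
  using assms unfolding bdd_measurable_def bounded_iff by auto

lemma bdd_measurable_measurable: "X \<in> bdd_measurable M \<Longrightarrow> X \<in> borel_measurable M"
  unfolding bdd_measurable_def by blast

lemma bdd_measurable_cong_sets: "sets N = sets M \<Longrightarrow> bdd_measurable N = bdd_measurable M"
  unfolding bdd_measurable_def by (metis measurable_cong_sets sets_eq_imp_space_eq)

lemma bdd_measurable_const [simp]: "(\<lambda>_. c) \<in> bdd_measurable M"
  by (rule bdd_measurableI[of _ _ "\<bar>c\<bar>"]) auto

lemma bdd_measurable_indicator: "A \<in> sets M \<Longrightarrow> indicator A \<in> bdd_measurable M"
  by (rule bdd_measurableI[of _ _ 1]) (auto simp: indicator_def)

lemma bdd_measurable_add:
  assumes "X \<in> bdd_measurable M" "Y \<in> bdd_measurable M"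
  shows "(\<lambda>\<omega>. X \<omega> + Y \<omega>) \<in> bdd_measurable M"
proof -
  obtain C where C: "X \<in> borel_measurable M" "\<And>\<omega>. \<omega> \<in> space M \<Longrightarrow> \<bar>X \<omega>\<bar> \<le> C"
    using bdd_measurableD[OF assms(1)] by metis
  obtain D where D: "Y \<in> borel_measurable M" "\<And>\<omega>. \<omega> \<in> space M \<Longrightarrow> \<bar>Y \<omega>\<bar> \<le> D"
    using bdd_measurableD[OF assms(2)] by metis
  show ?thesis
  proof (rule bdd_measurableI)
    show "\<bar>X \<omega> + Y \<omega>\<bar> \<le> C + D" if "\<omega> \<in> space M" for \<omega>
      using C(2)[OF that] D(2)[OF that] by linarith
  qed (use C(1) D(1) in measurable)
qed

lemma bdd_measurable_mult:
  assumes "X \<in> bdd_measurable M" "Y \<in> bdd_measurable M"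
  shows "(\<lambda>\<omega>. X \<omega> * Y \<omega>) \<in> bdd_measurable M"
proof -
  obtain C where C: "X \<in> borel_measurable M" "0 \<le> C" "\<And>\<omega>. \<omega> \<in> space M \<Longrightarrow> \<bar>X \<omega>\<bar> \<le> C"
    using bdd_measurableD[OF assms(1)] by metis
  obtain D where D: "Y \<in> borel_measurable M" "\<And>\<omega>. \<omega> \<in> space M \<Longrightarrow> \<bar>Y \<omega>\<bar> \<le> D"
    using bdd_measurableD[OF assms(2)] by metis
  show ?thesis
    using C D by (intro bdd_measurableI[of _ _ "C * D"]) (auto simp: abs_mult intro!: mult_mono)
qed

lemma bdd_measurable_diff:
  assumes "X \<in> bdd_measurable M" "Y \<in> bdd_measurable M"
  shows "(\<lambda>\<omega>. X \<omega> - Y \<omega>) \<in> bdd_measurable M"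
  using bdd_measurable_add[OF assms(1) bdd_measurable_mult[OF bdd_measurable_const[of "-1"] assms(2)]]
  by simp

lemma bdd_measurable_abs:
  assumes "X \<in> bdd_measurable M"
  shows "(\<lambda>\<omega>. \<bar>X \<omega>\<bar>) \<in> bdd_measurable M"
  by (rule bdd_measurableD[OF assms], rule bdd_measurableI) auto

lemma bdd_measurable_max:
  assumes "X \<in> bdd_measurable M" "Y \<in> bdd_measurable M"
  shows "(\<lambda>\<omega>. max (X \<omega>) (Y \<omega>)) \<in> bdd_measurable M"
proof -
  obtain C where C: "X \<in> borel_measurable M" "\<And>\<omega>. \<omega> \<in> space M \<Longrightarrow> \<bar>X \<omega>\<bar> \<le> C"
    using bdd_measurableD[OF assms(1)] by metis
  obtain D where D: "Y \<in> borel_measurable M" "\<And>\<omega>. \<omega> \<in> space M \<Longrightarrow> \<bar>Y \<omega>\<bar> \<le> D"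
    using bdd_measurableD[OF assms(2)] by metis
  show ?thesis
  proof (rule bdd_measurableI)
    show "\<bar>max (X \<omega>) (Y \<omega>)\<bar> \<le> max C D" if "\<omega> \<in> space M" for \<omega>
      using C(2)[OF that] D(2)[OF that] by linarith
  qed (use C(1) D(1) in measurable)
qed

lemma integrable_bdd_measurable:
  assumes "finite_measure N" "X \<in> bdd_measurable N"
  shows "integrable N X"
proof -
  interpret finite_measure N by fact
  obtain C where "X \<in> borel_measurable N" "0 \<le> C" "\<And>\<omega>. \<omega> \<in> space N \<Longrightarrow> \<bar>X \<omega>\<bar> \<le> C"
    using bdd_measurableD[OF assms(2)] by metis
  then show ?thesis by (intro integrable_const_bound[of _ C]) auto
qed

section \<open>Approximation of integrals by sums over values of the set function\<close>

text \<open>The integral of \<open>X\<close> rounded down to multiples of \<open>1 / Suc n\<close>,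
  summed over the values taken: a Lebesgue sum in spite of its name. \<open>Suc n\<close> keeps the
  mesh defined at \<open>n = 0\<close>.\<close>

definition riemann_sum :: "'a measure \<Rightarrow> ('a set \<Rightarrow> real) \<Rightarrow> ('a \<Rightarrow> real) \<Rightarrow> nat \<Rightarrow> real" where
  "riemann_sum M \<mu> X n =
    (\<Sum>k\<in>(\<lambda>\<omega>. \<lfloor>real (Suc n) * X \<omega>\<rfloor>) ` space M.
      real_of_int k / real (Suc n) * \<mu> {\<omega>\<in>space M. \<lfloor>real (Suc n) * X \<omega>\<rfloor> = k})"

text \<open>Rounding down moves \<open>X\<close> by at most \<open>1 / Suc n\<close>, hence moves
  the integral by at most that times the total mass.\<close>

lemma riemann_sum_tendsto:
  assumes N: "finite_measure N" and X: "X \<in> bdd_measurable N"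
  shows "riemann_sum N (measure N) X \<longlonglongrightarrow> (\<integral>\<omega>. X \<omega> \<partial>N)"
proof -
  interpret finite_measure N by fact
  obtain C where C: "X \<in> borel_measurable N" "0 \<le> C" "\<And>\<omega>. \<omega> \<in> space N \<Longrightarrow> \<bar>X \<omega>\<bar> \<le> C"
    using bdd_measurableD[OF X] by metis
  note [measurable] = C(1)
  have bnd: "\<bar>riemann_sum N (measure N) X n - (\<integral>\<omega>. X \<omega> \<partial>N)\<bar> \<le> inverse (real (Suc n)) * measure N (space N)"
    for n
  proof -
    let ?m = "real (Suc n)"
    let ?f = "\<lambda>\<omega>. \<lfloor>?m * X \<omega>\<rfloor>"
    let ?K = "?f ` space N"
    have "?K \<subseteq> {\<lfloor>- (?m * C)\<rfloor>..\<lfloor>?m * C\<rfloor>}"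
    proof safe
      fix \<omega> assume "\<omega> \<in> space N"
      then have "\<bar>?m * X \<omega>\<bar> \<le> ?m * C" using C(3)[of \<omega>] by (simp add: abs_mult mult_left_mono)
      then show "?f \<omega> \<in> {\<lfloor>- (?m * C)\<rfloor>..\<lfloor>?m * C\<rfloor>}"
        unfolding abs_le_iff by (auto intro!: floor_mono)
    qed
    then have fin: "finite ?K" by (rule finite_subset) simp
    have meas: "{\<omega>\<in>space N. ?f \<omega> = k} \<in> sets N" for k by measurable
    have eq: "(\<Sum>k\<in>?K. real_of_int k / ?m * indicator {\<omega>\<in>space N. ?f \<omega> = k} \<omega>) = real_of_int (?f \<omega>) / ?m"
      if "\<omega> \<in> space N" for \<omega>
    proof -
      have "(\<Sum>k\<in>?K. real_of_int k / ?m * indicator {\<omega>\<in>space N. ?f \<omega> = k} \<omega>) =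
        (\<Sum>k\<in>?K. if k = ?f \<omega> then real_of_int k / ?m else 0)"
        using that by (intro sum.cong) (auto simp: indicator_def)
      then show ?thesis using fin that by (simp add: sum.delta)
    qed
    have "riemann_sum N (measure N) X n =
        (\<Sum>k\<in>?K. (\<integral>\<omega>. real_of_int k / ?m * indicator {\<omega>\<in>space N. ?f \<omega> = k} \<omega> \<partial>N))"
      unfolding riemann_sum_def using meas by (intro sum.cong) (auto simp: Int_absorb1)
    also have "\<dots> = (\<integral>\<omega>. (\<Sum>k\<in>?K. real_of_int k / ?m * indicator {\<omega>\<in>space N. ?f \<omega> = k} \<omega>) \<partial>N)"
      using meas by (intro Bochner_Integration.integral_sum[symmetric]) (auto simp: emeasure_eq_measure)
    also have "\<dots> = (\<integral>\<omega>. real_of_int (?f \<omega>) / ?m \<partial>N)"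
      using eq by (intro Bochner_Integration.integral_cong) auto
    finally have R: "riemann_sum N (measure N) X n = (\<integral>\<omega>. real_of_int (?f \<omega>) / ?m \<partial>N)" .
    have close: "\<bar>real_of_int (?f \<omega>) / ?m - X \<omega>\<bar> \<le> inverse ?m" for \<omega>
    proof -
      have "\<bar>real_of_int (?f \<omega>) - ?m * X \<omega>\<bar> \<le> 1" by linarith
      then have "\<bar>real_of_int (?f \<omega>) - ?m * X \<omega>\<bar> / ?m \<le> 1 / ?m" by (intro divide_right_mono) auto
      also have "\<bar>real_of_int (?f \<omega>) - ?m * X \<omega>\<bar> / ?m = \<bar>(real_of_int (?f \<omega>) - ?m * X \<omega>) / ?m\<bar>" by simp
      also have "(real_of_int (?f \<omega>) - ?m * X \<omega>) / ?m = real_of_int (?f \<omega>) / ?m - X \<omega>"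
        by (simp add: diff_divide_distrib del: of_nat_Suc)
      finally show ?thesis by (simp add: inverse_eq_divide)
    qed
    have iX: "integrable N X" by (rule integrable_bdd_measurable[OF N X])
    have iD: "integrable N (\<lambda>\<omega>. real_of_int (?f \<omega>) / ?m - X \<omega>)"
      using close by (intro integrable_const_bound[of _ "inverse ?m"]) auto
    have "integrable N (\<lambda>\<omega>. (real_of_int (?f \<omega>) / ?m - X \<omega>) + X \<omega>)"
      using iD iX by (rule Bochner_Integration.integrable_add)
    then have iF: "integrable N (\<lambda>\<omega>. real_of_int (?f \<omega>) / ?m)" by simp
    have "\<bar>riemann_sum N (measure N) X n - (\<integral>\<omega>. X \<omega> \<partial>N)\<bar> = \<bar>\<integral>\<omega>. real_of_int (?f \<omega>) / ?m - X \<omega> \<partial>N\<bar>"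
      unfolding R using iF iX by simp
    also have "\<dots> \<le> (\<integral>\<omega>. \<bar>real_of_int (?f \<omega>) / ?m - X \<omega>\<bar> \<partial>N)" by simp
    also have "\<dots> \<le> (\<integral>\<omega>. inverse ?m \<partial>N)" using iD close by (intro integral_mono) auto
    finally show ?thesis by (simp add: mult.commute)
  qed
  have "(\<lambda>n. inverse (real (Suc n)) * measure N (space N)) \<longlonglongrightarrow> 0"
    using LIMSEQ_inverse_real_of_nat by (intro tendsto_mult_left_zero)
  then have "(\<lambda>n. riemann_sum N (measure N) X n - (\<integral>\<omega>. X \<omega> \<partial>N)) \<longlonglongrightarrow> 0"
    by (rule Lim_null_comparison[rotated]) (use bnd in auto)
  then show ?thesis by (simp add: LIM_zero_iff)
qed

text \<open>The Riemann sums see \<open>\<mu>\<close> only through its values, so the signed integral does not depend on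
  the representation of \<open>\<mu>\<close> as a difference of measures, and it is linear in \<open>\<mu>\<close>.\<close>

lemma riemann_sum_tendsto_diff:
  assumes "finite_measure \<alpha>" "finite_measure \<beta>" "sets \<alpha> = sets M" "sets \<beta> = sets M"
    and X: "X \<in> bdd_measurable M"
    and \<mu>: "\<And>A. A \<in> sets M \<Longrightarrow> \<mu> A = measure \<alpha> A - measure \<beta> A"
  shows "riemann_sum M \<mu> X \<longlonglongrightarrow> (\<integral>\<omega>. X \<omega> \<partial>\<alpha>) - (\<integral>\<omega>. X \<omega> \<partial>\<beta>)"
proof -
  note [measurable] = bdd_measurable_measurable[OF X]
  have sp: "space \<alpha> = space M" "space \<beta> = space M" using assms sets_eq_imp_space_eq by blast+
  have "{\<omega>\<in>space M. \<lfloor>real (Suc n) * X \<omega>\<rfloor> = k} \<in> sets M" for k n by measurable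
  then have "riemann_sum M \<mu> X = (\<lambda>n. riemann_sum \<alpha> (measure \<alpha>) X n - riemann_sum \<beta> (measure \<beta>) X n)"
    unfolding riemann_sum_def sp
    by (simp add: \<mu> sum_subtractf[symmetric] right_diff_distrib del: of_nat_Suc)
  moreover have "riemann_sum \<alpha> (measure \<alpha>) X \<longlonglongrightarrow> (\<integral>\<omega>. X \<omega> \<partial>\<alpha>)"
    using assms bdd_measurable_cong_sets by (intro riemann_sum_tendsto) blast+
  moreover have "riemann_sum \<beta> (measure \<beta>) X \<longlonglongrightarrow> (\<integral>\<omega>. X \<omega> \<partial>\<beta>)"
    using assms bdd_measurable_cong_sets by (intro riemann_sum_tendsto) blast+
  ultimately show ?thesis by (simp add: tendsto_diff)
qed

lemma riemann_sum_tendsto_signed_integral: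
  assumes "\<mu> \<in> ca M" "X \<in> bdd_measurable M"
  shows "riemann_sum M \<mu> X \<longlonglongrightarrow> signed_integral M \<mu> X"
  unfolding signed_integral_def
  by (intro riemann_sum_tendsto_diff finite_pos_part ca_eq_diff assms sets_pos_part)

text \<open>Both sides are limits of the same Riemann sums. Thus any decomposition into finite
  measures may replace the Jordan decomposition when an integral is computed.\<close>

lemma signed_integral_diff_measure:
  assumes "\<mu> \<in> ca M" "finite_measure \<alpha>" "finite_measure \<beta>" "sets \<alpha> = sets M" "sets \<beta> = sets M"
    and "X \<in> bdd_measurable M" "\<And>A. A \<in> sets M \<Longrightarrow> \<mu> A = measure \<alpha> A - measure \<beta> A"
  shows "signed_integral M \<mu> X = (\<integral>\<omega>. X \<omega> \<partial>\<alpha>) - (\<integral>\<omega>. X \<omega> \<partial>\<beta>)"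
  using riemann_sum_tendsto_signed_integral[OF assms(1,6)] riemann_sum_tendsto_diff[OF assms(2-7)]
  by (rule LIMSEQ_unique)

text \<open>The Jordan parts of a sum are in general not the sums of the Jordan parts, so additivity
  is read off the Riemann sums and passed to the limit.\<close>

lemma signed_integral_add_measure:
  assumes "\<mu> \<in> ca M" "\<nu> \<in> ca M" "X \<in> bdd_measurable M"
  shows "signed_integral M (\<lambda>A. \<mu> A + \<nu> A) X = signed_integral M \<mu> X + signed_integral M \<nu> X"
proof -
  have "riemann_sum M (\<lambda>A. \<mu> A + \<nu> A) X = (\<lambda>n. riemann_sum M \<mu> X n + riemann_sum M \<nu> X n)"
    unfolding riemann_sum_def by (simp add: sum.distrib distrib_left del: of_nat_Suc)
  then show ?thesis
    using riemann_sum_tendsto_signed_integral[OF ca_add[OF assms(1,2)] assms(3)]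
      tendsto_add[OF riemann_sum_tendsto_signed_integral[OF assms(1,3)]
        riemann_sum_tendsto_signed_integral[OF assms(2,3)]] LIMSEQ_unique by simp
qed

lemma signed_integral_scale_measure:
  assumes "\<mu> \<in> ca M" "X \<in> bdd_measurable M"
  shows "signed_integral M (\<lambda>A. r * \<mu> A) X = r * signed_integral M \<mu> X"
proof -
  have "riemann_sum M (\<lambda>A. r * \<mu> A) X = (\<lambda>n. r * riemann_sum M \<mu> X n)"
    unfolding riemann_sum_def by (simp add: sum_distrib_left mult_ac del: of_nat_Suc)
  then show ?thesis
    using riemann_sum_tendsto_signed_integral[OF ca_scale[OF assms(1)] assms(2)]
      tendsto_mult_left[OF riemann_sum_tendsto_signed_integral[OF assms]] LIMSEQ_unique by metis
qed

section \<open>Signed measures given by densities\<close>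

text \<open>The signed measure \<open>f dN\<close>. The value 0 off \<open>sets N\<close> matches
  the normalisation in \<open>ca\<close>; with \<open>f = 1\<close> a finite measure
  \<open>N\<close> itself becomes a set function in \<open>ca\<close>.\<close>

definition density_charge :: "'a measure \<Rightarrow> ('a \<Rightarrow> real) \<Rightarrow> 'a set \<Rightarrow> real" where
  "density_charge N f A = (if A \<in> sets N then \<integral>\<omega>. f \<omega> * indicator A \<omega> \<partial>N else 0)"

text \<open>\<open>ennreal\<close> sends negative values to 0, so the mass is at most the integral
  of \<open>\<bar>f\<bar>\<close>, whatever the sign of \<open>f\<close>.\<close>

lemma finite_measure_density:
  assumes f: "integrable N f"
  shows "finite_measure (density N (\<lambda>\<omega>. ennreal (f \<omega>)))"
proof (rule finite_measureI)
  have "emeasure (density N (\<lambda>\<omega>. ennreal (f \<omega>))) (space N) = (\<integral>\<^sup>+\<omega>. ennreal (f \<omega>) \<partial>N)"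
    using f by (subst emeasure_density) (auto intro!: nn_integral_cong simp: indicator_def)
  also have "\<dots> \<le> (\<integral>\<^sup>+\<omega>. ennreal (norm (f \<omega>)) \<partial>N)"
    by (intro nn_integral_mono ennreal_leI) auto
  also have "\<dots> < \<infinity>" using f unfolding integrable_iff_bounded by blast
  finally show "emeasure (density N (\<lambda>\<omega>. ennreal (f \<omega>))) (space (density N (\<lambda>\<omega>. ennreal (f \<omega>)))) \<noteq> \<infinity>"
    by simp
qed

lemma integrable_mult_indicator_right:
  assumes "integrable N f" "A \<in> sets N"
  shows "integrable N (\<lambda>\<omega>. f \<omega> * indicator A \<omega> :: real)"
  using integrable_mult_indicator[OF assms(2,1)] by (simp add: mult.commute)

lemma measure_density_real:
  assumes f: "integrable N f" "\<And>\<omega>. 0 \<le> f \<omega>" and A: "A \<in> sets N"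
  shows "measure (density N (\<lambda>\<omega>. ennreal (f \<omega>))) A = (\<integral>\<omega>. f \<omega> * indicator A \<omega> \<partial>N)"
proof -
  have "emeasure (density N (\<lambda>\<omega>. ennreal (f \<omega>))) A = (\<integral>\<^sup>+\<omega>. ennreal (f \<omega> * indicator A \<omega>) \<partial>N)"
    using f A by (subst emeasure_density) (auto intro!: nn_integral_cong simp: indicator_def)
  also have "\<dots> = ennreal (\<integral>\<omega>. f \<omega> * indicator A \<omega> \<partial>N)"
    using f A by (intro nn_integral_eq_integral integrable_mult_indicator_right) auto
  finally show ?thesis using f(2) unfolding measure_def by simp
qed

lemma integral_indicator_null:
  assumes "integrable N f" "finite_measure N" "A \<in> sets N" "measure N A = 0"
  shows "(\<integral>\<omega>. f \<omega> * indicator A \<omega> \<partial>N) = (0::real)"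
proof -
  interpret finite_measure N by fact
  have "A \<in> null_sets N" using assms by (auto simp: emeasure_eq_measure)
  then have "AE \<omega> in N. \<omega> \<notin> A" by (rule AE_not_in)
  then have "AE \<omega> in N. f \<omega> * indicator A \<omega> = 0" by (rule AE_mp) (auto intro!: AE_I2)
  then show ?thesis by (rule integral_eq_zero_AE)
qed

text \<open>Splitting \<open>f\<close> into positive and negative parts presents the charge as a
  difference of finite measures, the form used for membership in \<open>ca\<close> and for
  \<open>signed_integral_diff_measure\<close>.\<close>

lemma density_charge_eq_diff:
  assumes f: "integrable N f" and A: "A \<in> sets N"
  shows "density_charge N f A = measure (density N (\<lambda>\<omega>. ennreal (max 0 (f \<omega>)))) A -
    measure (density N (\<lambda>\<omega>. ennreal (max 0 (- f \<omega>)))) A"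
proof -
  have i: "integrable N (\<lambda>\<omega>. max 0 (f \<omega>))" "integrable N (\<lambda>\<omega>. max 0 (- f \<omega>))" using f by auto
  have "measure (density N (\<lambda>\<omega>. ennreal (max 0 (f \<omega>)))) A -
      measure (density N (\<lambda>\<omega>. ennreal (max 0 (- f \<omega>)))) A =
    (\<integral>\<omega>. max 0 (f \<omega>) * indicator A \<omega> - max 0 (- f \<omega>) * indicator A \<omega> \<partial>N)"
    using A i by (subst (1 2) measure_density_real) (auto simp: integrable_mult_indicator_right)
  also have "\<dots> = (\<integral>\<omega>. f \<omega> * indicator A \<omega> \<partial>N)"
    by (intro Bochner_Integration.integral_cong) (auto simp: indicator_def)
  finally show ?thesis using A by (simp add: density_charge_def)
qed

lemma density_charge_in_ca:
  assumes f: "integrable N f" and N: "sets N = sets M"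
  shows "density_charge N f \<in> ca M"
proof -
  let ?a = "density N (\<lambda>\<omega>. ennreal (max 0 (f \<omega>)))" and ?b = "density N (\<lambda>\<omega>. ennreal (max 0 (- f \<omega>)))"
  interpret a: finite_measure ?a using f by (intro finite_measure_density) auto
  interpret b: finite_measure ?b using f by (intro finite_measure_density) auto
  show ?thesis
    unfolding ca_def
  proof (safe)
    show "density_charge N f A = 0" if "A \<notin> sets M" for A
      using that N by (simp add: density_charge_def)
    fix A :: "nat \<Rightarrow> 'a set" assume A: "range A \<subseteq> sets M" "disjoint_family A"
    have "(\<lambda>n. measure ?a (A n) - measure ?b (A n)) sums (measure ?a (\<Union>n. A n) - measure ?b (\<Union>n. A n))"
      using A N by (intro sums_diff a.finite_measure_UNION b.finite_measure_UNION) auto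
    moreover have "A n \<in> sets N" for n using A N by auto
    ultimately show "(\<lambda>n. density_charge N f (A n)) sums density_charge N f (\<Union>n. A n)"
      using f by (simp add: density_charge_eq_diff)
  qed
qed

text \<open>The densities of the positive and negative parts of \<open>f\<close> serve as the
  decomposition, so the Hahn set of the charge never has to be found.\<close>

lemma signed_integral_density_charge:
  assumes f: "integrable N f" and N: "sets N = sets M" and X: "X \<in> bdd_measurable M"
  shows "signed_integral M (density_charge N f) X = (\<integral>\<omega>. f \<omega> * X \<omega> \<partial>N)"
proof -
  let ?a = "density N (\<lambda>\<omega>. ennreal (max 0 (f \<omega>)))" and ?b = "density N (\<lambda>\<omega>. ennreal (max 0 (- f \<omega>)))"
  obtain C where C: "X \<in> borel_measurable M" "\<And>\<omega>. \<omega> \<in> space M \<Longrightarrow> \<bar>X \<omega>\<bar> \<le> C"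
    using bdd_measurableD[OF X] by metis
  have XN[measurable]: "X \<in> borel_measurable N" using C(1) measurable_cong_sets[OF N refl] by blast
  have sp: "space N = space M" using N by (rule sets_eq_imp_space_eq)
  have int: "integrable N (\<lambda>\<omega>. g \<omega> * X \<omega>)" if "integrable N g" for g
  proof (rule Bochner_Integration.integrable_bound)
    show "integrable N (\<lambda>\<omega>. C * g \<omega>)" using that by auto
    show "AE \<omega> in N. norm (g \<omega> * X \<omega>) \<le> norm (C * g \<omega>)"
    proof (rule AE_I2)
      fix \<omega> assume "\<omega> \<in> space N"
      then have "\<bar>X \<omega>\<bar> \<le> \<bar>C\<bar>" using C(2)[of \<omega>] sp by auto
      then show "norm (g \<omega> * X \<omega>) \<le> norm (C * g \<omega>)"
        by (simp add: abs_mult mult.commute mult_right_mono)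
    qed
  qed (use that in measurable)
  have "signed_integral M (density_charge N f) X = (\<integral>\<omega>. X \<omega> \<partial>?a) - (\<integral>\<omega>. X \<omega> \<partial>?b)"
    using f N by (intro signed_integral_diff_measure[OF density_charge_in_ca[OF f N] _ _ _ _ X]
        finite_measure_density) (auto simp: density_charge_eq_diff)
  also have "\<dots> = (\<integral>\<omega>. max 0 (f \<omega>) * X \<omega> \<partial>N) - (\<integral>\<omega>. max 0 (- f \<omega>) * X \<omega> \<partial>N)"
    using f by (subst (1 2) integral_density) auto
  also have "\<dots> = (\<integral>\<omega>. max 0 (f \<omega>) * X \<omega> - max 0 (- f \<omega>) * X \<omega> \<partial>N)"
    using f by (intro Bochner_Integration.integral_diff[symmetric] int) auto
  also have "\<dots> = (\<integral>\<omega>. f \<omega> * X \<omega> \<partial>N)"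
    by (intro Bochner_Integration.integral_cong) (auto simp: max_def)
  finally show ?thesis .
qed

lemma density_charge_add:
  assumes "integrable N f" "integrable N g"
  shows "density_charge N (\<lambda>\<omega>. f \<omega> + g \<omega>) = (\<lambda>A. density_charge N f A + density_charge N g A)"
  using assms unfolding density_charge_def
  by (auto simp: fun_eq_iff distrib_right integrable_mult_indicator_right)

lemma density_charge_scale:
  "density_charge N (\<lambda>\<omega>. c * f \<omega>) = (\<lambda>A. c * density_charge N f A)"
  unfolding density_charge_def by (auto simp: fun_eq_iff mult.assoc)

text \<open>Links two views of \<open>g dN\<close>, as a measure and as a set function:
  Radon-Nikodym yields the former, functionals on \<open>ca_c\<close> act on the latter.\<close>

lemma density_charge_density:
  assumes g: "integrable N g" "\<And>\<omega>. 0 \<le> g \<omega>"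
  shows "density_charge (density N (\<lambda>\<omega>. ennreal (g \<omega>))) (\<lambda>_. 1) = density_charge N g"
  using g measure_density_real[OF g] unfolding density_charge_def
  by (auto simp: fun_eq_iff sets.Int_space_eq2)

text \<open>With a Hahn set \<open>H\<close>, the norm is the integral of \<open>f\<close> times the
  function equal to 1 on \<open>H\<close> and to -1 off \<open>H\<close>. The estimate makes passing
  from \<open>f\<close> to \<open>f dN\<close> a contraction from \<open>L1(N)\<close> into
  \<open>ca\<close>.\<close>

lemma tv_norm_density_charge_le:
  assumes f: "integrable N f" and N: "sets N = sets M"
  shows "tv_norm M (density_charge N f) \<le> (\<integral>\<omega>. \<bar>f \<omega>\<bar> \<partial>N)"
proof -
  let ?\<mu> = "density_charge N f"
  note \<mu> = density_charge_in_ca[OF f N]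
  obtain H where H: "H \<in> sets M"
    "\<And>A. A \<in> sets M \<Longrightarrow> measure (pos_part M ?\<mu>) A = ?\<mu> (A \<inter> H)"
    "\<And>A. A \<in> sets M \<Longrightarrow> measure (pos_part M (\<lambda>A. - ?\<mu> A)) A = - ?\<mu> (A - H)"
    by (rule Jordan_decomposition[OF \<mu>]) blast
  have sp: "space N = space M" using N by (rule sets_eq_imp_space_eq)
  have HM: "space M \<inter> H = H" using sets.sets_into_space[OF H(1)] by blast
  have "tv_norm M ?\<mu> = ?\<mu> H - ?\<mu> (space M - H)"
    unfolding tv_norm_eq[OF \<mu>] H(2)[OF sets.top] H(3)[OF sets.top] HM by simp
  also have "\<dots> = (\<integral>\<omega>. f \<omega> * indicator H \<omega> - f \<omega> * indicator (space M - H) \<omega> \<partial>N)"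
    using H(1) N f by (simp add: density_charge_def integrable_mult_indicator_right)
  also have "\<dots> \<le> (\<integral>\<omega>. \<bar>f \<omega>\<bar> \<partial>N)"
    using H(1) N f by (intro integral_mono Bochner_Integration.integrable_diff integrable_mult_indicator_right)
      (auto simp: indicator_def)
  finally show ?thesis .
qed

section \<open>The dual of $L^1$ of a finite measure\<close>

text \<open>On the event where \<open>Y < X\<close> the nonnegative function \<open>X - Y\<close>
  has integral at most 0, so it vanishes almost everywhere there and the event is null.\<close>

lemma AE_le_if_integral_le:
  assumes X: "integrable N X" and Y: "integrable N Y"
    and le: "\<And>A. A \<in> sets N \<Longrightarrow> (\<integral>\<omega>. X \<omega> * indicator A \<omega> \<partial>N) \<le> (\<integral>\<omega>. Y \<omega> * indicator A \<omega> \<partial>N)"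
  shows "AE \<omega> in N. X \<omega> \<le> (Y \<omega> :: real)"
proof -
  define A where "A = {\<omega>\<in>space N. Y \<omega> < X \<omega>}"
  have A: "A \<in> sets N" unfolding A_def using X Y by measurable
  let ?f = "\<lambda>\<omega>. X \<omega> * indicator A \<omega> - Y \<omega> * indicator A \<omega>"
  have i: "integrable N (\<lambda>\<omega>. X \<omega> * indicator A \<omega>)" "integrable N (\<lambda>\<omega>. Y \<omega> * indicator A \<omega>)"
    using integrable_mult_indicator_right[OF X A] integrable_mult_indicator_right[OF Y A] by auto
  have nn: "0 \<le> ?f \<omega>" if "\<omega> \<in> space N" for \<omega> using that unfolding A_def by (auto simp: indicator_def)
  have "(\<integral>\<omega>. ?f \<omega> \<partial>N) \<le> 0" using i le[OF A] by simp
  moreover have "0 \<le> (\<integral>\<omega>. ?f \<omega> \<partial>N)" using nn by (intro Bochner_Integration.integral_nonneg) auto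
  ultimately have "(\<integral>\<omega>. ?f \<omega> \<partial>N) = 0" by simp
  moreover have "integrable N ?f" using i by simp
  ultimately have "AE \<omega> in N. ?f \<omega> = 0"
    using nn by (subst integral_nonneg_eq_0_iff_AE[symmetric]) (auto intro!: AE_I2)
  then show ?thesis
    by (rule AE_mp) (auto intro!: AE_I2 simp: A_def indicator_def split: if_splits)
qed

text \<open>Dominated convergence gives convergence in \<open>L1\<close>, and the bound on
  \<open>\<Phi>\<close> makes it Lipschitz there. Used for countable additivity and for the limit
  step of the representation.\<close>

lemma L1_dual_continuous:
  fixes \<Phi> :: "('a \<Rightarrow> real) \<Rightarrow> real"
  assumes add: "\<And>f g. integrable N f \<Longrightarrow> integrable N g \<Longrightarrow> \<Phi> (\<lambda>\<omega>. f \<omega> + g \<omega>) = \<Phi> f + \<Phi> g"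
    and scale: "\<And>c f. integrable N f \<Longrightarrow> \<Phi> (\<lambda>\<omega>. c * f \<omega>) = c * \<Phi> f"
    and bound: "\<And>f. integrable N f \<Longrightarrow> \<bar>\<Phi> f\<bar> \<le> K * (\<integral>\<omega>. \<bar>f \<omega>\<bar> \<partial>N)"
    and s: "\<And>i. integrable N (s i)" and f: "integrable N f" and g: "integrable N g"
    and lim: "\<And>\<omega>. \<omega> \<in> space N \<Longrightarrow> (\<lambda>i::nat. s i \<omega>) \<longlonglongrightarrow> f \<omega>"
    and dom: "\<And>i \<omega>. \<omega> \<in> space N \<Longrightarrow> \<bar>s i \<omega>\<bar> \<le> g \<omega>"
  shows "(\<lambda>i. \<Phi> (s i)) \<longlonglongrightarrow> \<Phi> f"
proof -
  have "(\<lambda>i. \<integral>\<omega>. \<bar>s i \<omega> - f \<omega>\<bar> \<partial>N) \<longlonglongrightarrow> (\<integral>\<omega>. 0 \<partial>N)"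
  proof (rule integral_dominated_convergence)
    show "integrable N (\<lambda>\<omega>. g \<omega> + \<bar>f \<omega>\<bar>)" using f g by auto
    show "AE \<omega> in N. (\<lambda>i. \<bar>s i \<omega> - f \<omega>\<bar>) \<longlonglongrightarrow> 0"
      by (rule AE_I2) (metis lim LIM_zero tendsto_rabs_zero)
    show "AE \<omega> in N. norm \<bar>s i \<omega> - f \<omega>\<bar> \<le> g \<omega> + \<bar>f \<omega>\<bar>" for i
    proof (rule AE_I2)
      show "norm \<bar>s i \<omega> - f \<omega>\<bar> \<le> g \<omega> + \<bar>f \<omega>\<bar>" if "\<omega> \<in> space N" for \<omega>
        using dom[OF that, of i] unfolding real_norm_def by linarith
    qed
  qed (use s f in auto)
  then have "(\<lambda>i. K * (\<integral>\<omega>. \<bar>s i \<omega> - f \<omega>\<bar> \<partial>N)) \<longlonglongrightarrow> 0" by (simp add: tendsto_mult_right_zero)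
  moreover have "norm (\<Phi> (s i) - \<Phi> f) \<le> K * (\<integral>\<omega>. \<bar>s i \<omega> - f \<omega>\<bar> \<partial>N)" for i
  proof -
    have "\<Phi> (\<lambda>\<omega>. s i \<omega> + (-1) * f \<omega>) = \<Phi> (s i) + \<Phi> (\<lambda>\<omega>. (-1) * f \<omega>)"
      using s f by (intro add) auto
    then have "\<Phi> (\<lambda>\<omega>. s i \<omega> - f \<omega>) = \<Phi> (s i) - \<Phi> f" using scale[OF f, of "-1"] by simp
    then show ?thesis using bound[of "\<lambda>\<omega>. s i \<omega> - f \<omega>"] s f by simp
  qed
  ultimately have "(\<lambda>i. \<Phi> (s i) - \<Phi> f) \<longlonglongrightarrow> 0"
    by (rule Lim_null_comparison[OF always_eventually[OF allI], rotated])
  then show ?thesis by (rule LIM_zero_cancel)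
qed

lemma finite_measure_ac_density:
  assumes N: "finite_measure N" and Q: "finite_measure Q" "sets Q = sets N"
    and ac: "\<And>A. A \<in> sets N \<Longrightarrow> measure N A = 0 \<Longrightarrow> measure Q A = 0"
  obtains g where "integrable N g" "\<And>\<omega>. 0 \<le> g \<omega>" "Q = density N (\<lambda>\<omega>. ennreal (g \<omega>))"
proof -
  interpret N: finite_measure N by fact
  interpret Q: finite_measure Q by fact
  have ac: "absolutely_continuous N Q"
    unfolding absolutely_continuous_def null_sets_def
    using ac Q(2) by (auto simp: N.emeasure_eq_measure Q.emeasure_eq_measure)
  obtain D where D: "D \<in> borel_measurable N" "AE \<omega> in N. RN_deriv N Q \<omega> = ennreal (D \<omega>)"
    "\<And>\<omega>. 0 \<le> D \<omega>"
    by (rule N.real_RN_deriv[OF Q(1) ac Q(2)]) blast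
  note [measurable] = D(1)
  have QD: "Q = density N (\<lambda>\<omega>. ennreal (D \<omega>))"
    using N.density_RN_deriv[OF ac Q(2)] density_cong[OF _ _ D(2)] D(1) by simp
  have "(\<integral>\<^sup>+\<omega>. ennreal (D \<omega>) \<partial>N) = emeasure Q (space N)"
    unfolding QD using D(1) by (subst emeasure_density) (auto intro!: nn_integral_cong simp: indicator_def)
  then have "integrable N D"
    using D Q.emeasure_finite[of "space N"] by (intro integrableI_nonneg) (auto simp: less_top[symmetric])
  then show thesis using that D(3) QD by blast
qed

text \<open>Adding \<open>K\<close> times the measure makes the functional positive, so Radon-Nikodym for positive
  measures suffices.\<close>

theorem L1_dual_representation:
  fixes \<Phi> :: "('a \<Rightarrow> real) \<Rightarrow> real"
  assumes N: "finite_measure N"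
    and add: "\<And>f g. integrable N f \<Longrightarrow> integrable N g \<Longrightarrow> \<Phi> (\<lambda>\<omega>. f \<omega> + g \<omega>) = \<Phi> f + \<Phi> g"
    and scale: "\<And>c f. integrable N f \<Longrightarrow> \<Phi> (\<lambda>\<omega>. c * f \<omega>) = c * \<Phi> f"
    and bound: "\<And>f. integrable N f \<Longrightarrow> \<bar>\<Phi> f\<bar> \<le> K * (\<integral>\<omega>. \<bar>f \<omega>\<bar> \<partial>N)" and K: "0 \<le> K"
  obtains Z where "Z \<in> borel_measurable N" "\<And>\<omega>. \<bar>Z \<omega>\<bar> \<le> K"
    "\<And>f. integrable N f \<Longrightarrow> \<Phi> f = (\<integral>\<omega>. f \<omega> * Z \<omega> \<partial>N)"
proof -
  interpret finite_measure N by fact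
  have ind: "integrable N (indicator A :: 'a \<Rightarrow> real)" if "A \<in> sets N" for A
    using that by (simp add: emeasure_eq_measure)
  have zero: "\<Phi> (\<lambda>_. 0) = 0" using scale[of "\<lambda>_. 0" 0] by simp
  define m where "m A = \<Phi> (indicator A) + K * measure N A" for A
  \<comment> \<open>The bound on \<open>\<Phi>\<close> confines \<open>\<Phi> (indicator A)\<close>
    to plus or minus \<open>K * measure N A\<close>. The upper estimate later yields absolute
    continuity and the density bound \<open>2 * K\<close>.\<close>
  have m: "0 \<le> m A" "m A \<le> 2 * K * measure N A" if "A \<in> sets N" for A
    using bound[OF ind[OF that]] that unfolding m_def by (auto simp: abs_le_iff Int_absorb1 sets.sets_into_space)
  have m_sums: "(\<lambda>n. m (A n)) sums m (\<Union>n. A n)"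
    if A: "range A \<subseteq> sets N" "disjoint_family A" for A :: "nat \<Rightarrow> 'a set"
  proof -
    have An: "A n \<in> sets N" for n using A(1) by auto
    let ?s = "\<lambda>n \<omega>. \<Sum>i<n. indicator (A i) \<omega> :: real"
    have int: "integrable N (?s n)" for n using ind[OF An] by auto
    have "\<Phi> (?s n) = (\<Sum>i<n. \<Phi> (indicator (A i)))" for n
    proof (induction n)
      case (Suc n)
      then show ?case using add[OF int[of n] ind[OF An[of n]]] by simp
    qed (simp add: zero)
    \<comment> \<open>The partial sums of the indicators are dominated by 1 and converge pointwise
      to the indicator of the union, so continuity of \<open>\<Phi>\<close> gives countable
      additivity.\<close>
    moreover have "(\<lambda>n. \<Phi> (?s n)) \<longlonglongrightarrow> \<Phi> (indicator (\<Union>n. A n))"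
    proof (rule L1_dual_continuous[OF add scale bound int])
      show "integrable N (indicator (\<Union>n. A n) :: 'a \<Rightarrow> real)" using An by (intro ind) auto
      show "integrable N (\<lambda>_. 1::real)" by simp
      have sums: "(\<lambda>n. indicator (A n) \<omega> :: real) sums indicator (\<Union>n. A n) \<omega>" for \<omega>
        by (rule indicator_sums[OF A(2)[unfolded disjoint_family_on_def, rule_format]]) auto
      then show "(\<lambda>n. ?s n \<omega>) \<longlonglongrightarrow> indicator (\<Union>n. A n) \<omega>" for \<omega>
        unfolding sums_def .
      have "?s n \<omega> \<le> indicator (\<Union>n. A n) \<omega>" for n \<omega>
        using sum_le_suminf[OF sums_summable[OF sums[of \<omega>]], of "{..<n}"] sums_unique[OF sums[of \<omega>]]
        by auto
      also have "indicator (\<Union>n. A n) \<omega> \<le> (1::real)" for \<omega> by (simp add: indicator_def)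
      finally show "\<bar>?s n \<omega>\<bar> \<le> 1" for n \<omega> by (simp add: sum_nonneg)
    qed
    ultimately have "(\<lambda>n. \<Phi> (indicator (A n))) sums \<Phi> (indicator (\<Union>n. A n))" by (simp add: sums_def)
    then show ?thesis
      unfolding m_def by (intro sums_add sums_mult finite_measure_UNION A)
  qed
  define L where "L = measure_of (space N) (sets N) (\<lambda>A. ennreal (m A))"
  have L_sets: "sets L = sets N" unfolding L_def by (rule sets.sets_measure_of_eq)
  have L_em: "emeasure L A = ennreal (m A)" if A: "A \<in> sets N" for A
    unfolding L_def
  proof (rule emeasure_measure_of_sigma[OF sets.sigma_algebra_axioms _ _ A])
    have "indicator {} = (\<lambda>_ :: 'a. 0 :: real)" by (simp add: fun_eq_iff)
    then have "m {} = 0" unfolding m_def by (simp only: zero) simp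
    then show "positive (sets N) (\<lambda>A. ennreal (m A))" unfolding positive_def by simp
    show "countably_additive (sets N) (\<lambda>A. ennreal (m A))"
      unfolding countably_additive_def
    proof (intro allI impI)
      fix F :: "nat \<Rightarrow> 'a set"
      assume F: "range F \<subseteq> sets N" "disjoint_family F" "\<Union> (range F) \<in> sets N"
      then have "(\<lambda>n. ennreal (m (F n))) sums ennreal (m (\<Union>n. F n))"
        using m_sums[OF F(1,2)] by (subst sums_ennreal) (auto intro!: m(1))
      then show "(\<Sum>i. ennreal (m (F i))) = ennreal (m (\<Union> (range F)))" by (simp add: sums_iff)
    qed
  qed
  have L_fin: "finite_measure L"
    by (rule finite_measureI) (simp add: L_em L_sets sets_eq_imp_space_eq[OF L_sets])
  have "measure L A = 0" if "A \<in> sets N" "measure N A = 0" for A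
    using m[OF that(1)] L_em[OF that(1)] that(2) by (simp add: measure_def)
  then obtain D where D: "integrable N D" "\<And>\<omega>. 0 \<le> D \<omega>" "L = density N (\<lambda>\<omega>. ennreal (D \<omega>))"
    using finite_measure_ac_density[OF N L_fin L_sets] by metis
  have [measurable]: "D \<in> borel_measurable N" using D(1) by auto
  have mD: "m A = (\<integral>\<omega>. D \<omega> * indicator A \<omega> \<partial>N)" if A: "A \<in> sets N" for A
    using measure_density_real[OF D(1,2) A] L_em[OF A] m(1)[OF A] unfolding D(3)[symmetric] measure_def
    by simp
  have "AE \<omega> in N. D \<omega> \<le> 2 * K"
  proof (rule AE_le_if_integral_le[OF D(1)])
    fix A assume A: "A \<in> sets N"
    then show "(\<integral>\<omega>. D \<omega> * indicator A \<omega> \<partial>N) \<le> (\<integral>\<omega>. 2 * K * indicator A \<omega> \<partial>N)"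
      using m(2)[OF A] mD[OF A] by (simp add: Int_absorb1 sets.sets_into_space)
  qed simp
  \<comment> \<open>Subtracting \<open>K\<close> undoes the shift made in \<open>m\<close>. Since
    \<open>D \<omega> \<le> 2 * K\<close> holds only almost everywhere, the truncation is what makes
    the bound by \<open>K\<close> hold everywhere.\<close>
  define Z where "Z \<omega> = min (D \<omega>) (2 * K) - K" for \<omega>
  have Zm[measurable]: "Z \<in> borel_measurable N" unfolding Z_def by measurable
  have Z_bound: "\<bar>Z \<omega>\<bar> \<le> K" for \<omega> using D(2)[of \<omega>] K unfolding Z_def by (auto simp: min_def)
  have fZ: "integrable N (\<lambda>\<omega>. f \<omega> * Z \<omega>)" if "integrable N f" for f
  proof (rule Bochner_Integration.integrable_bound)
    show "integrable N (\<lambda>\<omega>. K * f \<omega>)" using that by auto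
    show "AE \<omega> in N. norm (f \<omega> * Z \<omega>) \<le> norm (K * f \<omega>)"
      using Z_bound K by (intro AE_I2) (simp add: abs_mult mult.commute mult_right_mono)
  qed (use that in measurable)
  have ind_Z: "\<Phi> (indicator A) = (\<integral>\<omega>. indicator A \<omega> * Z \<omega> \<partial>N)" if A: "A \<in> sets N" for A
  proof -
    have "(\<integral>\<omega>. indicator A \<omega> * Z \<omega> \<partial>N) = (\<integral>\<omega>. D \<omega> * indicator A \<omega> - K * indicator A \<omega> \<partial>N)"
    proof (rule integral_cong_AE)
      show "AE \<omega> in N. indicator A \<omega> * Z \<omega> = D \<omega> * indicator A \<omega> - K * indicator A \<omega>"
        using \<open>AE \<omega> in N. D \<omega> \<le> 2 * K\<close> by eventually_elim (simp add: Z_def algebra_simps)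
    qed (use A in measurable)
    also have "\<dots> = m A - K * measure N A"
      using A D(1) ind[OF A] mD[OF A] integrable_mult_indicator_right[OF D(1) A]
      by (simp add: Int_absorb1 sets.sets_into_space)
    finally show ?thesis unfolding m_def by simp
  qed
  show thesis
  proof (rule that[OF Zm Z_bound])
    \<comment> \<open>From indicators the formula extends by linearity to simple functions and by
      \<open>L1\<close> continuity to all integrable functions.\<close>
    show "\<Phi> f = (\<integral>\<omega>. f \<omega> * Z \<omega> \<partial>N)" if "integrable N f" for f
      using that
    proof (induction rule: integrable_induct)
      case (base A c)
      have "\<Phi> (\<lambda>\<omega>. indicator A \<omega> *\<^sub>R c) = c * \<Phi> (indicator A)"
        using scale[OF ind[OF base(1)], of c] by (simp add: mult.commute)
      also have "\<dots> = (\<integral>\<omega>. c * (indicator A \<omega> * Z \<omega>) \<partial>N)"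
        by (simp add: ind_Z base(1))
      finally show ?case by (simp add: mult_ac)
    next
      case (add f g)
      then show ?case using assms(2)[of f g] fZ by (simp add: distrib_right)
    next
      case (lim f s)
      have dom: "\<bar>s i \<omega>\<bar> \<le> 2 * \<bar>f \<omega>\<bar>" if "\<omega> \<in> space N" for i \<omega> using lim(3)[OF that, of i] by simp
      have "(\<lambda>i. \<Phi> (s i)) \<longlonglongrightarrow> \<Phi> f"
        using lim dom by (intro L1_dual_continuous[OF assms(2,3) bound, where g = "\<lambda>\<omega>. 2 * \<bar>f \<omega>\<bar>"]) auto
      moreover have "(\<lambda>i. \<integral>\<omega>. s i \<omega> * Z \<omega> \<partial>N) \<longlonglongrightarrow> (\<integral>\<omega>. f \<omega> * Z \<omega> \<partial>N)"
      proof (rule integral_dominated_convergence)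
        show "integrable N (\<lambda>\<omega>. 2 * \<bar>f \<omega>\<bar> * K)" using lim(4) by auto
        show "AE \<omega> in N. (\<lambda>i. s i \<omega> * Z \<omega>) \<longlonglongrightarrow> f \<omega> * Z \<omega>"
          using lim(2) by (intro AE_I2 tendsto_mult) auto
        show "AE \<omega> in N. norm (s i \<omega> * Z \<omega>) \<le> 2 * \<bar>f \<omega>\<bar> * K" for i
          using dom Z_bound by (intro AE_I2) (auto simp: abs_mult intro!: mult_mono)
      qed (use lim(1,4) in measurable)
      ultimately show ?case using lim(5) LIMSEQ_unique by simp
    qed
  qed
qed

section \<open>Measures dominated by the capacity\<close>

lemma qs_mono: "qs \<P> Q \<Longrightarrow> (\<And>\<omega>. Q \<omega> \<Longrightarrow> R \<omega>) \<Longrightarrow> qs \<P> R"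
  unfolding qs_def by (auto elim: AE_mp)

lemma qs_conj: "qs \<P> Q \<Longrightarrow> qs \<P> R \<Longrightarrow> qs \<P> (\<lambda>\<omega>. Q \<omega> \<and> R \<omega>)"
  unfolding qs_def by auto

lemma qs_subst:
  assumes "qs \<P> (\<lambda>\<omega>. X \<omega> = Y \<omega>)"
  shows "qs \<P> (\<lambda>\<omega>. R \<omega> (X \<omega>)) \<longleftrightarrow> qs \<P> (\<lambda>\<omega>. R \<omega> (Y \<omega>))"
proof
  assume "qs \<P> (\<lambda>\<omega>. R \<omega> (X \<omega>))"
  from qs_conj[OF this assms] show "qs \<P> (\<lambda>\<omega>. R \<omega> (Y \<omega>))" by (rule qs_mono) auto
next
  assume "qs \<P> (\<lambda>\<omega>. R \<omega> (Y \<omega>))"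
  from qs_conj[OF this assms] show "qs \<P> (\<lambda>\<omega>. R \<omega> (X \<omega>))" by (rule qs_mono) auto
qed

text \<open>A bounded increasing net converges to its supremum. The finite subsets serve as indices
  because \<open>D\<close> may be uncountable.\<close>

lemma tendsto_finite_subsets_mono:
  fixes g :: "'b set \<Rightarrow> real"
  assumes mono: "\<And>F G. finite G \<Longrightarrow> F \<subseteq> G \<Longrightarrow> G \<subseteq> D \<Longrightarrow> g F \<le> g G"
    and bound: "\<And>F. finite F \<Longrightarrow> F \<subseteq> D \<Longrightarrow> g F \<le> B"
  shows "(g \<longlongrightarrow> Sup (g ` {F. finite F \<and> F \<subseteq> D})) (finite_subsets_at_top D)" (is "(g \<longlongrightarrow> ?s) _")
proof (rule order_tendstoI)
  have bdd: "bdd_above (g ` {F. finite F \<and> F \<subseteq> D})" using bound by (intro bdd_aboveI[of _ B]) auto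
  show "eventually (\<lambda>F. g F < a) (finite_subsets_at_top D)" if "?s < a" for a
  proof (rule eventually_finite_subsets_at_top_weakI)
    fix F assume "finite F" "F \<subseteq> D"
    then have "g F \<le> ?s" using bdd by (intro cSup_upper) auto
    then show "g F < a" using that by simp
  qed
  show "eventually (\<lambda>F. a < g F) (finite_subsets_at_top D)" if a: "a < ?s" for a
  proof -
    have "g ` {F. finite F \<and> F \<subseteq> D} \<noteq> {}" by blast
    then obtain F where F: "finite F" "F \<subseteq> D" "a < g F"
      using less_cSup_iff[OF _ bdd] a by auto
    then show ?thesis
      unfolding eventually_finite_subsets_at_top
      using mono by (intro exI[of _ F]) (auto intro: less_le_trans)
  qed
qed

locale prob_family =
  fixes M :: "'a measure" and \<P> :: "'a measure set"
  assumes nonempty: "\<P> \<noteq> {}"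
    and prob: "\<And>P. P \<in> \<P> \<Longrightarrow> prob_space P"
    and sets_eq: "\<And>P. P \<in> \<P> \<Longrightarrow> sets P = sets M"
begin

section \<open>Polar sets and the finite measures vanishing on them\<close>

definition polar :: "'a set \<Rightarrow> bool" where
  "polar A \<longleftrightarrow> A \<in> sets M \<and> (\<forall>P\<in>\<P>. measure P A = 0)"

text \<open>These are the positive elements of \<open>ca_c\<close>, kept as measures so that
  integrals and densities are directly available.\<close>

definition dominated :: "'a measure \<Rightarrow> bool" where
  "dominated N \<longleftrightarrow> finite_measure N \<and> sets N = sets M \<and> (\<forall>A. polar A \<longrightarrow> measure N A = 0)"

lemma space_eq: "P \<in> \<P> \<Longrightarrow> space P = space M"
  using sets_eq sets_eq_imp_space_eq by blast

lemma finite_measure_family: "P \<in> \<P> \<Longrightarrow> finite_measure P"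
  using prob prob_space.finite_measure by blast

lemma polar_iff_cap:
  assumes "A \<in> sets M"
  shows "polar A \<longleftrightarrow> cap \<P> A = 0"
proof
  assume "polar A"
  then have "(\<lambda>P. measure P A) ` \<P> = {0}" using nonempty unfolding polar_def by auto
  then show "cap \<P> A = 0" unfolding cap_def by simp
next
  assume *: "cap \<P> A = 0"
  have "bdd_above ((\<lambda>P. measure P A) ` \<P>)"
    using prob prob_space.prob_le_1 by (intro bdd_aboveI[of _ 1]) auto
  then have "measure P A \<le> 0" if "P \<in> \<P>" for P
    using * cSUP_upper[OF that, of "\<lambda>P. measure P A"] unfolding cap_def by simp
  then show "polar A" using assms unfolding polar_def by (auto intro: antisym)
qed

lemma qs_iff_polar:
  assumes "{\<omega>\<in>space M. \<not> Q \<omega>} \<in> sets M"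
  shows "qs \<P> Q \<longleftrightarrow> polar {\<omega>\<in>space M. \<not> Q \<omega>}"
proof -
  have "(AE \<omega> in P. Q \<omega>) \<longleftrightarrow> measure P {\<omega>\<in>space M. \<not> Q \<omega>} = 0" if "P \<in> \<P>" for P
  proof -
    interpret prob_space P using that by (rule prob)
    show ?thesis
      using assms by (subst AE_iff_measurable[OF _ refl])
        (auto simp: space_eq[OF that] sets_eq[OF that] emeasure_eq_measure)
  qed
  then show ?thesis using assms unfolding qs_def polar_def by auto
qed

text \<open>Measurability of the exceptional set turns the quasi-sure statement into polarity of one
  event, on which \<open>N\<close> vanishes; a nonmeasurable exceptional set might be covered only
  by null sets that vary with \<open>P\<close>.\<close>

lemma AE_dominated:
  assumes N: "dominated N" and Q: "qs \<P> Q" "{\<omega>\<in>space M. \<not> Q \<omega>} \<in> sets M"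
  shows "AE \<omega> in N. Q \<omega>"
proof -
  interpret finite_measure N using N unfolding dominated_def by blast
  have "space N = space M" using N sets_eq_imp_space_eq unfolding dominated_def by blast
  moreover have "measure N {\<omega>\<in>space M. \<not> Q \<omega>} = 0"
    using qs_iff_polar[OF Q(2)] Q(1) N unfolding dominated_def by blast
  ultimately show ?thesis
    using N Q(2) by (subst AE_iff_measurable[OF _ refl]) (auto simp: dominated_def emeasure_eq_measure)
qed

lemma AE_dominated_le:
  assumes "dominated N" "qs \<P> (\<lambda>\<omega>. X \<omega> \<le> Y \<omega>)" "X \<in> bdd_measurable M" "Y \<in> bdd_measurable M"
  shows "AE \<omega> in N. X \<omega> \<le> (Y \<omega> :: real)"
proof -
  note [measurable] = bdd_measurable_measurable[OF assms(3)] bdd_measurable_measurable[OF assms(4)]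
  have "{\<omega>\<in>space M. \<not> X \<omega> \<le> Y \<omega>} \<in> sets M" by measurable
  then show ?thesis by (intro AE_dominated[OF assms(1,2)])
qed

lemma dominated_family: "P \<in> \<P> \<Longrightarrow> dominated P"
  unfolding dominated_def polar_def using finite_measure_family sets_eq by blast

lemma dominatedD:
  assumes "dominated N"
  shows "finite_measure N" "sets N = sets M" "space N = space M"
  using assms sets_eq_imp_space_eq unfolding dominated_def by blast+

lemma integrable_dominated:
  assumes "dominated N" "X \<in> bdd_measurable M"
  shows "integrable N X"
  using assms bdd_measurable_cong_sets[OF dominatedD(2)[OF assms(1)]] dominatedD
  by (intro integrable_bdd_measurable) auto

lemma integral_mono_qs:
  assumes "dominated N" "qs \<P> (\<lambda>\<omega>. X \<omega> \<le> Y \<omega>)" "X \<in> bdd_measurable M" "Y \<in> bdd_measurable M"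
  shows "(\<integral>\<omega>. X \<omega> \<partial>N) \<le> (\<integral>\<omega>. Y \<omega> \<partial>N)"
  using assms by (intro integral_mono_AE integrable_dominated AE_dominated_le)

lemma integral_cong_qs:
  assumes "dominated N" "qs \<P> (\<lambda>\<omega>. X \<omega> = Y \<omega>)" "X \<in> bdd_measurable M" "Y \<in> bdd_measurable M"
  shows "(\<integral>\<omega>. X \<omega> \<partial>N) = (\<integral>\<omega>. Y \<omega> \<partial>N)"
  using assms by (intro antisym integral_mono_qs) (auto elim: qs_mono)

lemma dominated_density:
  assumes "dominated N" "integrable N g" "\<And>\<omega>. 0 \<le> g \<omega>"
  shows "dominated (density N (\<lambda>\<omega>. ennreal (g \<omega>)))"
  unfolding dominated_def
proof (intro conjI allI impI)
  show "finite_measure (density N (\<lambda>\<omega>. ennreal (g \<omega>)))" using assms(2) by (rule finite_measure_density)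
  show "sets (density N (\<lambda>\<omega>. ennreal (g \<omega>))) = sets M" using dominatedD[OF assms(1)] by simp
  fix A assume "polar A"
  then have "A \<in> sets N" "measure N A = 0" using assms(1) unfolding dominated_def polar_def by auto
  then show "measure (density N (\<lambda>\<omega>. ennreal (g \<omega>))) A = 0"
    using integral_indicator_null[OF assms(2) dominatedD(1)[OF assms(1)]]
    by (simp add: measure_density_real[OF assms(2,3)])
qed

lemma density_charge_in_ca_c:
  assumes N: "dominated N" and f: "integrable N f"
  shows "density_charge N f \<in> ca_c M \<P>"
proof -
  have "density_charge N f A = 0" if "A \<in> sets M" "cap \<P> A = 0" for A
  proof -
    have "polar A" using polar_iff_cap that by blast
    then have "measure N A = 0" using N unfolding dominated_def by blast
    then show ?thesis
      using integral_indicator_null[OF f dominatedD(1)[OF N]] that(1) dominatedD(2)[OF N]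
      by (simp add: density_charge_def)
  qed
  then show ?thesis
    unfolding ca_c_def using density_charge_in_ca[OF f dominatedD(2)[OF N]] by blast
qed

lemma ca_c_in_ca: "\<mu> \<in> ca_c M \<P> \<Longrightarrow> \<mu> \<in> ca M"
  unfolding ca_c_def by blast

lemma ca_c_add: "\<mu> \<in> ca_c M \<P> \<Longrightarrow> \<nu> \<in> ca_c M \<P> \<Longrightarrow> (\<lambda>A. \<mu> A + \<nu> A) \<in> ca_c M \<P>"
  unfolding ca_c_def by (auto intro: ca_add)

lemma ca_c_scale: "\<mu> \<in> ca_c M \<P> \<Longrightarrow> (\<lambda>A. r * \<mu> A) \<in> ca_c M \<P>"
  unfolding ca_c_def by (auto intro: ca_scale)

text \<open>\<open>ca_c\<close> speaks of \<open>\<mu>\<close> only at the polar set itself.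
  Monotonicity of each \<open>P\<close> extends this to its measurable subsets, as required for the
  Jordan parts.\<close>

lemma ca_c_eq_0:
  assumes "\<mu> \<in> ca_c M \<P>" "polar A" "B \<in> sets M" "B \<subseteq> A"
  shows "\<mu> B = 0"
proof -
  have "measure P B = 0" if "P \<in> \<P>" for P
  proof -
    interpret prob_space P using that by (rule prob)
    have "measure P B \<le> measure P A"
      using assms(2,4) sets_eq[OF that] unfolding polar_def by (intro finite_measure_mono) auto
    then show ?thesis using assms(2) that measure_nonneg[of P B] unfolding polar_def by auto
  qed
  then have "polar B" using assms(3) unfolding polar_def by blast
  then have "cap \<P> B = 0" using polar_iff_cap[OF assms(3)] by blast
  then show ?thesis using assms(1,3) unfolding ca_c_def by blast
qed

text \<open>The parts at a polar \<open>A\<close> are, up to sign, the values of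
  \<open>\<mu>\<close> at the subsets \<open>A \<inter> H\<close> and \<open>A - H\<close>, which
  vanish.\<close>

lemma dominated_pos_part:
  assumes \<mu>: "\<mu> \<in> ca_c M \<P>"
  shows "dominated (pos_part M \<mu>)" "dominated (pos_part M (\<lambda>A. - \<mu> A))"
proof -
  obtain H where H: "H \<in> sets M"
    "\<And>A. A \<in> sets M \<Longrightarrow> measure (pos_part M \<mu>) A = \<mu> (A \<inter> H)"
    "\<And>A. A \<in> sets M \<Longrightarrow> measure (pos_part M (\<lambda>A. - \<mu> A)) A = - \<mu> (A - H)"
    by (rule Jordan_decomposition[OF ca_c_in_ca[OF \<mu>]]) blast
  have "\<mu> (A \<inter> H) = 0" "\<mu> (A - H) = 0" "A \<in> sets M" if "polar A" for A
    using ca_c_eq_0[OF \<mu> that] H(1) that unfolding polar_def by auto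
  then show "dominated (pos_part M \<mu>)" "dominated (pos_part M (\<lambda>A. - \<mu> A))"
    unfolding dominated_def using H(2,3) finite_pos_part[OF ca_c_in_ca[OF \<mu>]] by auto
qed

text \<open>Localising the elements of \<open>\<P>\<close> to events shows that \<open>ca_c\<close> determines the
  quasi-sure order.\<close>

lemma qs_leI:
  assumes X: "X \<in> bdd_measurable M" and Y: "Y \<in> bdd_measurable M"
    and le: "\<And>N. dominated N \<Longrightarrow> (\<integral>\<omega>. X \<omega> \<partial>N) \<le> (\<integral>\<omega>. Y \<omega> \<partial>N)"
  shows "qs \<P> (\<lambda>\<omega>. X \<omega> \<le> Y \<omega>)"
  unfolding qs_def
proof
  fix P assume P: "P \<in> \<P>"
  note D = dominated_family[OF P]
  show "AE \<omega> in P. X \<omega> \<le> Y \<omega>"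
  proof (rule AE_le_if_integral_le)
    show i: "integrable P X" "integrable P Y" using integrable_dominated[OF D] X Y by auto
    fix A assume A: "A \<in> sets P"
    have "integrable P (indicator A :: 'a \<Rightarrow> real)"
      using A finite_measure.emeasure_eq_measure[OF dominatedD(1)[OF D]] by simp
    then have "dominated (density P (\<lambda>\<omega>. ennreal (indicator A \<omega>)))"
      by (intro dominated_density[OF D]) auto
    then have "(\<integral>\<omega>. X \<omega> \<partial>density P (\<lambda>\<omega>. ennreal (indicator A \<omega>))) \<le>
        (\<integral>\<omega>. Y \<omega> \<partial>density P (\<lambda>\<omega>. ennreal (indicator A \<omega>)))" by (rule le)
    then show "(\<integral>\<omega>. X \<omega> * indicator A \<omega> \<partial>P) \<le> (\<integral>\<omega>. Y \<omega> * indicator A \<omega> \<partial>P)"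
      using i A by (subst (asm) (1 2) integral_density) (auto simp: mult.commute)
  qed
qed

lemma signed_integral_dominated:
  assumes "dominated N" "X \<in> bdd_measurable M"
  shows "signed_integral M (density_charge N (\<lambda>_. 1)) X = (\<integral>\<omega>. X \<omega> \<partial>N)"
  using signed_integral_density_charge[OF
      finite_measure.integrable_const[OF dominatedD(1)[OF assms(1)]] dominatedD(2)[OF assms(1)] assms(2)]
  by simp

lemma density_charge_1_in_ca_c: "dominated N \<Longrightarrow> density_charge N (\<lambda>_. 1) \<in> ca_c M \<P>"
  using finite_measure.integrable_const dominatedD(1) by (intro density_charge_in_ca_c) blast+

lemma abs_signed_integral_le:
  assumes \<mu>: "\<mu> \<in> ca_c M \<P>" and X: "X \<in> bdd_measurable M" and K: "qs \<P> (\<lambda>\<omega>. \<bar>X \<omega>\<bar> \<le> K)"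
  shows "\<bar>signed_integral M \<mu> X\<bar> \<le> K * tv_norm M \<mu>"
proof -
  have *: "\<bar>\<integral>\<omega>. X \<omega> \<partial>N\<bar> \<le> K * measure N (space M)" if N: "dominated N" for N
  proof -
    have "\<bar>\<integral>\<omega>. X \<omega> \<partial>N\<bar> \<le> (\<integral>\<omega>. \<bar>X \<omega>\<bar> \<partial>N)" by simp
    also have "\<dots> \<le> (\<integral>\<omega>. K \<partial>N)"
      by (intro integral_mono_qs[OF N K] bdd_measurable_abs X) simp
    finally show ?thesis by (simp add: mult.commute dominatedD(3)[OF N])
  qed
  show ?thesis
    using *[OF dominated_pos_part(1)[OF \<mu>]] *[OF dominated_pos_part(2)[OF \<mu>]]
    unfolding signed_integral_def tv_norm_eq[OF ca_c_in_ca[OF \<mu>]] distrib_left by linarith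
qed

section \<open>Quasi-sure equivalence classes\<close>

lemma equiv_qs_rel: "equiv (bdd_measurable M) (qs_rel M \<P>)"
proof (rule equivI)
  show "qs_rel M \<P> \<subseteq> bdd_measurable M \<times> bdd_measurable M" unfolding qs_rel_def by auto
  show "refl_on (bdd_measurable M) (qs_rel M \<P>)" unfolding refl_on_def qs_rel_def qs_def by auto
  show "sym (qs_rel M \<P>)" unfolding sym_def qs_rel_def by (auto elim: qs_mono)
  show "trans (qs_rel M \<P>)"
    unfolding trans_def qs_rel_def
  proof safe
    fix X Y Z assume "qs \<P> (\<lambda>\<omega>. X \<omega> = Y \<omega>)" "qs \<P> (\<lambda>\<omega>. Y \<omega> = (Z \<omega> :: real))"
    from qs_conj[OF this] show "qs \<P> (\<lambda>\<omega>. X \<omega> = Z \<omega>)" by (rule qs_mono) simp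
  qed
qed

lemma cls_in_Linf: "X \<in> bdd_measurable M \<Longrightarrow> cls M \<P> X \<in> Linf M \<P>"
  unfolding Linf_def cls_def by (rule quotientI)

lemma in_Linf_iff_rel:
  assumes "a \<in> Linf M \<P>" "X \<in> a"
  shows "Y \<in> a \<longleftrightarrow> (X, Y) \<in> qs_rel M \<P>"
  using assms quotient_eq_iff[OF equiv_qs_rel, of a a X Y] equiv_class_eq_iff[OF equiv_qs_rel]
  unfolding Linf_def quotient_def by auto

lemma rep_in:
  assumes "a \<in> Linf M \<P>"
  shows "rep a \<in> a"
proof -
  have "a \<noteq> {}" using in_quotient_imp_non_empty[OF equiv_qs_rel] assms unfolding Linf_def .
  then show ?thesis unfolding rep_def by (simp add: some_in_eq)
qed

lemma rep_bdd: "a \<in> Linf M \<P> \<Longrightarrow> rep a \<in> bdd_measurable M"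
  using rep_in in_Linf_iff_rel[OF _ rep_in, of a "rep a"] unfolding qs_rel_def by auto

lemma rep_cls:
  assumes "X \<in> bdd_measurable M"
  shows "qs \<P> (\<lambda>\<omega>. rep (cls M \<P> X) \<omega> = X \<omega>)"
proof -
  have "rep (cls M \<P> X) \<in> cls M \<P> X" by (intro rep_in cls_in_Linf assms)
  then show ?thesis unfolding cls_def qs_rel_def by (auto elim: qs_mono)
qed

section \<open>Order and norm in terms of representatives\<close>

text \<open>Any two representatives of a class agree quasi-surely, so the witnesses in
  \<open>Linf_le\<close> may be exchanged for the chosen ones.\<close>

lemma Linf_le_iff:
  assumes a: "a \<in> Linf M \<P>" and b: "b \<in> Linf M \<P>"
  shows "Linf_le \<P> a b \<longleftrightarrow> qs \<P> (\<lambda>\<omega>. rep a \<omega> \<le> rep b \<omega>)"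
proof
  assume "Linf_le \<P> a b"
  then obtain X Y where XY: "X \<in> a" "Y \<in> b" "qs \<P> (\<lambda>\<omega>. X \<omega> \<le> Y \<omega>)" unfolding Linf_le_def by blast
  have "qs \<P> (\<lambda>\<omega>. rep a \<omega> = X \<omega>)" "qs \<P> (\<lambda>\<omega>. rep b \<omega> = Y \<omega>)"
    using in_Linf_iff_rel[OF a rep_in[OF a]] in_Linf_iff_rel[OF b rep_in[OF b]] XY(1,2)
    unfolding qs_rel_def by auto
  from qs_conj[OF XY(3) qs_conj[OF this]] show "qs \<P> (\<lambda>\<omega>. rep a \<omega> \<le> rep b \<omega>)"
    by (rule qs_mono) simp
qed (auto simp: Linf_le_def intro: rep_in[OF a] rep_in[OF b])

lemma Linf_le_cls_iff:
  assumes "a \<in> Linf M \<P>" "X \<in> bdd_measurable M"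
  shows "Linf_le \<P> a (cls M \<P> X) \<longleftrightarrow> qs \<P> (\<lambda>\<omega>. rep a \<omega> \<le> X \<omega>)"
    and "Linf_le \<P> (cls M \<P> X) a \<longleftrightarrow> qs \<P> (\<lambda>\<omega>. X \<omega> \<le> rep a \<omega>)"
  unfolding Linf_le_iff[OF assms(1) cls_in_Linf[OF assms(2)]] Linf_le_iff[OF cls_in_Linf[OF assms(2)] assms(1)]
  using qs_subst[OF rep_cls[OF assms(2)], of "\<lambda>\<omega> x. rep a \<omega> \<le> x"]
    qs_subst[OF rep_cls[OF assms(2)], of "\<lambda>\<omega> x. x \<le> rep a \<omega>"] by simp_all

lemma Linf_le_cls_cls_iff:
  assumes X: "X \<in> bdd_measurable M" and Y: "Y \<in> bdd_measurable M"
  shows "Linf_le \<P> (cls M \<P> X) (cls M \<P> Y) \<longleftrightarrow> qs \<P> (\<lambda>\<omega>. X \<omega> \<le> Y \<omega>)"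
  unfolding Linf_le_cls_iff(1)[OF cls_in_Linf[OF X] Y]
  by (rule qs_subst[OF rep_cls[OF X], where R = "\<lambda>\<omega> x. x \<le> Y \<omega>"])

lemma prob_abs_le_iff:
  assumes "a \<in> Linf M \<P>"
  shows "(\<forall>P\<in>\<P>. measure P {\<omega>\<in>space P. \<bar>rep a \<omega>\<bar> \<le> m} = 1) \<longleftrightarrow> qs \<P> (\<lambda>\<omega>. \<bar>rep a \<omega>\<bar> \<le> m)"
proof -
  have "measure P {\<omega>\<in>space P. \<bar>rep a \<omega>\<bar> \<le> m} = 1 \<longleftrightarrow> (AE \<omega> in P. \<bar>rep a \<omega>\<bar> \<le> m)" if "P \<in> \<P>" for P
  proof -
    interpret prob_space P using that by (rule prob)
    have [measurable]: "rep a \<in> borel_measurable P"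
      using bdd_measurable_measurable[OF rep_bdd[OF assms]] measurable_cong_sets[OF sets_eq[OF that] refl]
      by blast
    have "{\<omega>\<in>space P. \<bar>rep a \<omega>\<bar> \<le> m} \<in> events" by measurable
    then show ?thesis by (subst prob_eq_1) (auto intro!: AE_cong)
  qed
  then show ?thesis unfolding qs_def by auto
qed

text \<open>Strictness provides an admissible bound below \<open>K\<close>, so attainment of the
  infimum is never at issue. Boundedness of the representative ensures that admissible bounds
  exist.\<close>

lemma Linf_norm_leD:
  assumes a: "a \<in> Linf M \<P>" and K: "Linf_norm \<P> a < K"
  shows "qs \<P> (\<lambda>\<omega>. \<bar>rep a \<omega>\<bar> \<le> K)"
proof -
  let ?S = "{m. qs \<P> (\<lambda>\<omega>. \<bar>rep a \<omega>\<bar> \<le> m)}"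
  obtain C where C: "\<And>\<omega>. \<omega> \<in> space M \<Longrightarrow> \<bar>rep a \<omega>\<bar> \<le> C" using bdd_measurableD[OF rep_bdd[OF a]] by metis
  have "C \<in> ?S" unfolding qs_def using C space_eq by (auto intro!: AE_I2)
  then have "?S \<noteq> {}" by blast
  moreover have "Inf ?S < K" using K unfolding Linf_norm_def prob_abs_le_iff[OF a] .
  ultimately obtain m where "m < K" "qs \<P> (\<lambda>\<omega>. \<bar>rep a \<omega>\<bar> \<le> m)" using cInf_lessD[of ?S K] by auto
  then show ?thesis by (auto elim: qs_mono)
qed

text \<open>\<open>K\<close> is an admissible bound, so it lies above the infimum once the
  admissible bounds are bounded below; any member of the nonempty \<open>\<P>\<close> shows that
  they are nonnegative.\<close>

lemma Linf_norm_leI: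
  assumes a: "a \<in> Linf M \<P>" and K: "qs \<P> (\<lambda>\<omega>. \<bar>rep a \<omega>\<bar> \<le> K)"
  shows "Linf_norm \<P> a \<le> K"
  unfolding Linf_norm_def prob_abs_le_iff[OF a]
proof (rule cInf_lower)
  obtain P where P: "P \<in> \<P>" using nonempty by blast
  interpret prob_space P using P by (rule prob)
  have "0 \<le> m" if "qs \<P> (\<lambda>\<omega>. \<bar>rep a \<omega>\<bar> \<le> m)" for m
  proof -
    have "qs \<P> (\<lambda>\<omega>. 0 \<le> m)" using that by (rule qs_mono) simp
    then have "AE \<omega> in P. 0 \<le> m" using P unfolding qs_def by blast
    then show ?thesis by simp
  qed
  then show "bdd_below {m. qs \<P> (\<lambda>\<omega>. \<bar>rep a \<omega>\<bar> \<le> m)}" by (intro bdd_belowI[of _ 0]) simp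
qed (use K in simp)

section \<open>Order completeness and the dual\<close>

theorem order_complete_if_dual:
  assumes dual: "ca_c_dual_eq_Linf M \<P>"
  shows "Linf_order_complete M \<P>"
  unfolding Linf_order_complete_def
proof (intro allI impI)
  fix D assume D: "D \<subseteq> Linf M \<P>" "D \<noteq> {}" and "\<exists>K. \<forall>a\<in>D. Linf_norm \<P> a \<le> K"
  then obtain K0 where K0: "\<And>a. a \<in> D \<Longrightarrow> Linf_norm \<P> a \<le> K0" by blast
  \<comment> \<open>The margin 1 gives the strict inequality that turns the norm bound into a
    quasi-sure bound.\<close>
  define K where "K = K0 + 1"
  have K: "qs \<P> (\<lambda>\<omega>. \<bar>rep a \<omega>\<bar> \<le> K)" if "a \<in> D" for a
    using Linf_norm_leD[of a K] K0[OF that] D(1) that unfolding K_def by auto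
  obtain d0 where d0: "d0 \<in> D" using D(2) by blast
  \<comment> \<open>Inserting \<open>d0\<close> keeps the maximum over a nonempty set when
    \<open>F\<close> is empty; it does not affect the limit, as \<open>d0\<close> lies in
    \<open>D\<close>.\<close>
  define m where "m F \<omega> = Max ((\<lambda>d. rep d \<omega>) ` insert d0 F)" for F \<omega>
  have m_bdd: "m F \<in> bdd_measurable M" if "finite F" "F \<subseteq> D" for F
    using that
  proof (induction F)
    case empty
    have "m {} = rep d0" unfolding m_def by (simp add: fun_eq_iff)
    then show ?case using rep_bdd d0 D(1) by auto
  next
    case (insert d F)
    have "m (insert d F) = (\<lambda>\<omega>. max (rep d \<omega>) (m F \<omega>))"
    proof
      fix \<omega>
      have "insert d0 (insert d F) = insert d (insert d0 F)" by blast
      then have "(\<lambda>e. rep e \<omega>) ` insert d0 (insert d F) = insert (rep d \<omega>) ((\<lambda>e. rep e \<omega>) ` insert d0 F)"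
        by (metis image_insert)
      then show "m (insert d F) \<omega> = max (rep d \<omega>) (m F \<omega>)"
        unfolding m_def using insert(1) by (simp only:) (subst Max_insert, auto)
    qed
    moreover have "(\<lambda>\<omega>. max (rep d \<omega>) (m F \<omega>)) \<in> bdd_measurable M"
      using insert D(1) by (intro bdd_measurable_max rep_bdd) auto
    ultimately show ?case by simp
  qed
  have m_le: "m F \<omega> \<le> m G \<omega>" if "finite G" "F \<subseteq> G" for F G \<omega>
    unfolding m_def using that by (intro Max_mono) auto
  have m_ge: "rep d \<omega> \<le> m F \<omega>" if "finite F" "d \<in> F" for d F \<omega>
    unfolding m_def using that by (intro Max_ge) auto
  \<comment> \<open>At each point the maximum is one of finitely many values, so a predicate holding
    quasi-surely for every member of \<open>D\<close> passes to the maximum.\<close>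
  have m_qs: "qs \<P> (\<lambda>\<omega>. R (m F \<omega>) \<omega>)" if F: "finite F" "F \<subseteq> D" and R: "\<And>d. d \<in> D \<Longrightarrow> qs \<P> (\<lambda>\<omega>. R (rep d \<omega>) \<omega>)"
    for F R
  proof -
    have "m F \<omega> \<in> (\<lambda>d. rep d \<omega>) ` insert d0 F" for \<omega>
      unfolding m_def using F(1) by (intro Max_in) auto
    moreover have "qs \<P> (\<lambda>\<omega>. \<forall>d\<in>insert d0 F. R (rep d \<omega>) \<omega>)"
      unfolding qs_def
    proof
      fix P assume P: "P \<in> \<P>"
      have "finite (insert d0 F)" using F(1) by simp
      moreover have "AE \<omega> in P. R (rep d \<omega>) \<omega>" if "d \<in> insert d0 F" for d
        using R[of d] P that F(2) d0 unfolding qs_def by blast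
      ultimately show "AE \<omega> in P. \<forall>d\<in>insert d0 F. R (rep d \<omega>) \<omega>" by (simp add: AE_finite_all)
    qed
    ultimately show ?thesis by (elim qs_mono) (metis (mono_tags, lifting) imageE)
  qed
  let ?T = "finite_subsets_at_top D"
  have conv: "\<exists>L. ((\<lambda>F. \<integral>\<omega>. m F \<omega> \<partial>N) \<longlongrightarrow> L) ?T" if N: "dominated N" for N
  proof (rule exI, rule tendsto_finite_subsets_mono)
    fix F assume F: "finite F" "F \<subseteq> D"
    show "(\<integral>\<omega>. m F \<omega> \<partial>N) \<le> (\<integral>\<omega>. K \<partial>N)"
    proof (rule integral_mono_qs[OF N _ m_bdd[OF F]])
      show "qs \<P> (\<lambda>\<omega>. m F \<omega> \<le> K)"
        by (rule m_qs[OF F, where R = "\<lambda>x _. x \<le> K"], rule qs_mono[OF K]) auto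
    qed simp
  next
    fix F G assume "finite G" "F \<subseteq> G" "G \<subseteq> D"
    then show "(\<integral>\<omega>. m F \<omega> \<partial>N) \<le> (\<integral>\<omega>. m G \<omega> \<partial>N)"
      using m_le by (intro integral_mono integrable_dominated[OF N] m_bdd) (auto intro: finite_subset)
  qed
  define \<phi> where "\<phi> = (\<lambda>\<mu>\<in>ca_c M \<P>. Lim ?T (\<lambda>F. signed_integral M \<mu> (m F)))"
  \<comment> \<open>\<open>Lim\<close> is meaningful only where a limit exists; here one exists
    because the integrals against both Jordan parts converge as bounded increasing nets.\<close>
  have lim: "((\<lambda>F. signed_integral M \<mu> (m F)) \<longlongrightarrow> \<phi> \<mu>) ?T" if \<mu>: "\<mu> \<in> ca_c M \<P>" for \<mu>
  proof -
    obtain L L' where "((\<lambda>F. \<integral>\<omega>. m F \<omega> \<partial>pos_part M \<mu>) \<longlongrightarrow> L) ?T"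
      "((\<lambda>F. \<integral>\<omega>. m F \<omega> \<partial>pos_part M (\<lambda>A. - \<mu> A)) \<longlongrightarrow> L') ?T"
      using conv dominated_pos_part[OF \<mu>] by metis
    then have "((\<lambda>F. signed_integral M \<mu> (m F)) \<longlongrightarrow> L - L') ?T"
      unfolding signed_integral_def by (rule tendsto_diff)
    then show ?thesis unfolding \<phi>_def using \<mu> by (simp add: tendsto_Lim)
  qed
  have "\<phi> \<in> ca_c_dual M \<P>"
    unfolding ca_c_dual_def
  proof (intro CollectI conjI ballI allI)
    show "\<phi> \<in> extensional (ca_c M \<P>)" unfolding \<phi>_def by simp
    show "\<phi> (\<lambda>A. \<mu> A + \<nu> A) = \<phi> \<mu> + \<phi> \<nu>" if "\<mu> \<in> ca_c M \<P>" "\<nu> \<in> ca_c M \<P>" for \<mu> \<nu>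
    proof (rule tendsto_unique[OF finite_subsets_at_top_neq_bot lim[OF ca_c_add[OF that]]])
      have "eventually (\<lambda>F. signed_integral M \<mu> (m F) + signed_integral M \<nu> (m F) =
          signed_integral M (\<lambda>A. \<mu> A + \<nu> A) (m F)) ?T"
        using that by (intro eventually_finite_subsets_at_top_weakI)
          (simp add: signed_integral_add_measure ca_c_in_ca m_bdd)
      then show "((\<lambda>F. signed_integral M (\<lambda>A. \<mu> A + \<nu> A) (m F)) \<longlongrightarrow> \<phi> \<mu> + \<phi> \<nu>) ?T"
        by (rule Lim_transform_eventually[OF tendsto_add[OF lim[OF that(1)] lim[OF that(2)]]])
    qed
    show "\<phi> (\<lambda>A. r * \<mu> A) = r * \<phi> \<mu>" if "\<mu> \<in> ca_c M \<P>" for r \<mu>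
    proof (rule tendsto_unique[OF finite_subsets_at_top_neq_bot lim[OF ca_c_scale[OF that]]])
      have "eventually (\<lambda>F. r * signed_integral M \<mu> (m F) = signed_integral M (\<lambda>A. r * \<mu> A) (m F)) ?T"
        using that by (intro eventually_finite_subsets_at_top_weakI)
          (simp add: signed_integral_scale_measure ca_c_in_ca m_bdd)
      then show "((\<lambda>F. signed_integral M (\<lambda>A. r * \<mu> A) (m F)) \<longlongrightarrow> r * \<phi> \<mu>) ?T"
        by (rule Lim_transform_eventually[OF tendsto_mult_left[OF lim[OF that]]])
    qed
    have "\<bar>\<phi> \<mu>\<bar> \<le> K * tv_norm M \<mu>" if "\<mu> \<in> ca_c M \<P>" for \<mu>
    proof (rule tendsto_upperbound[OF tendsto_rabs[OF lim[OF that]] _ finite_subsets_at_top_neq_bot])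
      show "eventually (\<lambda>F. \<bar>signed_integral M \<mu> (m F)\<bar> \<le> K * tv_norm M \<mu>) ?T"
        using K by (intro eventually_finite_subsets_at_top_weakI abs_signed_integral_le[OF that] m_bdd
            m_qs[where R = "\<lambda>x _. \<bar>x\<bar> \<le> K"])
    qed
    then show "\<exists>K. \<forall>\<mu>\<in>ca_c M \<P>. \<bar>\<phi> \<mu>\<bar> \<le> K * tv_norm M \<mu>" by blast
  qed
  then obtain a where a: "a \<in> Linf M \<P>" "\<And>\<mu>. \<mu> \<in> ca_c M \<P> \<Longrightarrow> \<phi> \<mu> = signed_integral M \<mu> (rep a)"
    using dual unfolding ca_c_dual_eq_Linf_def by blast
  \<comment> \<open>A dominated measure is an element of \<open>ca_c\<close> through its charge with
    density 1, so the representative of \<open>\<phi>\<close> computes the limits of its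
    integrals.\<close>
  have lim_a: "((\<lambda>F. \<integral>\<omega>. m F \<omega> \<partial>N) \<longlongrightarrow> (\<integral>\<omega>. rep a \<omega> \<partial>N)) ?T" if N: "dominated N" for N
  proof -
    have "eventually (\<lambda>F. signed_integral M (density_charge N (\<lambda>_. 1)) (m F) = (\<integral>\<omega>. m F \<omega> \<partial>N)) ?T"
      by (intro eventually_finite_subsets_at_top_weakI signed_integral_dominated[OF N] m_bdd)
    from Lim_transform_eventually[OF lim[OF density_charge_1_in_ca_c[OF N]] this] show ?thesis
      using a N by (simp add: density_charge_1_in_ca_c signed_integral_dominated rep_bdd)
  qed
  show "\<exists>s. is_supremum M \<P> D s"
    unfolding is_supremum_def
  proof (intro exI[of _ a] conjI ballI impI)
    show "a \<in> Linf M \<P>" by (rule a(1))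
    \<comment> \<open>The quasi-sure order is tested by integrals: from \<open>{d}\<close> on, every
      finite maximum lies above the representative of \<open>d\<close>, so the limit of the
      integrals does not fall below its integral.\<close>
    show "Linf_le \<P> d a" if d: "d \<in> D" for d
    proof -
      have dL: "d \<in> Linf M \<P>" using d D(1) by blast
      show ?thesis
        unfolding Linf_le_iff[OF dL a(1)]
      proof (rule qs_leI[OF rep_bdd[OF dL] rep_bdd[OF a(1)]])
        fix N assume N: "dominated N"
        have "eventually (\<lambda>F. (\<integral>\<omega>. rep d \<omega> \<partial>N) \<le> (\<integral>\<omega>. m F \<omega> \<partial>N)) ?T"
          unfolding eventually_finite_subsets_at_top
        proof (intro exI[of _ "{d}"] conjI allI impI)
          fix F assume "finite F \<and> {d} \<subseteq> F \<and> F \<subseteq> D"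
          then show "(\<integral>\<omega>. rep d \<omega> \<partial>N) \<le> (\<integral>\<omega>. m F \<omega> \<partial>N)"
            using m_ge by (intro integral_mono integrable_dominated[OF N] m_bdd rep_bdd dL) auto
        qed (use d in auto)
        then show "(\<integral>\<omega>. rep d \<omega> \<partial>N) \<le> (\<integral>\<omega>. rep a \<omega> \<partial>N)"
          by (rule tendsto_lowerbound[OF lim_a[OF N] _ finite_subsets_at_top_neq_bot])
      qed
    qed
    \<comment> \<open>Every finite maximum lies quasi-surely below an upper bound \<open>u\<close>,
      and this passes to the limit of the integrals.\<close>
    show "Linf_le \<P> a u" if u: "u \<in> Linf M \<P>" "\<forall>d\<in>D. Linf_le \<P> d u" for u
      unfolding Linf_le_iff[OF a(1) u(1)]
    proof (rule qs_leI[OF rep_bdd[OF a(1)] rep_bdd[OF u(1)]])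
      fix N assume N: "dominated N"
      have du: "qs \<P> (\<lambda>\<omega>. rep d \<omega> \<le> rep u \<omega>)" if "d \<in> D" for d
        using u that D(1) Linf_le_iff by blast
      have "eventually (\<lambda>F. (\<integral>\<omega>. m F \<omega> \<partial>N) \<le> (\<integral>\<omega>. rep u \<omega> \<partial>N)) ?T"
      proof (rule eventually_finite_subsets_at_top_weakI)
        fix F assume F: "finite F" "F \<subseteq> D"
        show "(\<integral>\<omega>. m F \<omega> \<partial>N) \<le> (\<integral>\<omega>. rep u \<omega> \<partial>N)"
          by (rule integral_mono_qs[OF N m_qs[OF F, where R = "\<lambda>x \<omega>. x \<le> rep u \<omega>", OF du] m_bdd[OF F] rep_bdd[OF u(1)]])
      qed
      then show "(\<integral>\<omega>. rep a \<omega> \<partial>N) \<le> (\<integral>\<omega>. rep u \<omega> \<partial>N)"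
        by (rule tendsto_upperbound[OF lim_a[OF N] _ finite_subsets_at_top_neq_bot])
    qed
  qed
qed

text \<open>The complement of \<open>S\<close> is the supremum of all \<open>N\<close>-null events, and order continuity of
  integration against \<open>N\<close> makes it \<open>N\<close>-null itself.\<close>

lemma order_support:
  assumes complete: "Linf_order_complete M \<P>" and ocd: "order_continuous_dual_eq_ca_c M \<P>"
    and N: "dominated N"
  obtains S where "S \<in> sets M" "measure N (space M - S) = 0"
    "\<And>A. A \<in> sets M \<Longrightarrow> A \<subseteq> S \<Longrightarrow> measure N A = 0 \<Longrightarrow> polar A"
proof -
  interpret finite_measure N using N by (rule dominatedD(1))
  note setsN = dominatedD(2)[OF N]
  define I where "I = {A\<in>sets M. measure N A = 0}"
  define i where "i A = cls M \<P> (indicator A :: 'a \<Rightarrow> real)" for A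
  have ind: "(indicator A :: 'a \<Rightarrow> real) \<in> bdd_measurable M" if "A \<in> I" for A
    using that unfolding I_def by (intro bdd_measurable_indicator) auto
  have i: "i A \<in> Linf M \<P>" if "A \<in> I" for A unfolding i_def using ind[OF that] by (rule cls_in_Linf)
  have "Linf_norm \<P> a \<le> 1" if a: "a \<in> i ` I" for a
  proof -
    obtain A where A: "A \<in> I" "a = i A" using a by blast
    have "qs \<P> (\<lambda>\<omega>. \<bar>rep (i A) \<omega>\<bar> \<le> 1)"
      unfolding i_def by (rule qs_mono[OF rep_cls[OF ind[OF A(1)]]]) (simp add: indicator_def)
    then show ?thesis unfolding A(2) by (rule Linf_norm_leI[OF i[OF A(1)]])
  qed
  moreover have "{} \<in> I" unfolding I_def by simp
  ultimately obtain s where "is_supremum M \<P> (i ` I) s"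
    using complete i unfolding Linf_order_complete_def by (metis empty_iff image_is_empty image_subsetI)
  then have s: "s \<in> Linf M \<P>" and up: "\<And>A. A \<in> I \<Longrightarrow> Linf_le \<P> (i A) s"
    and least: "\<And>u. u \<in> Linf M \<P> \<Longrightarrow> (\<And>A. A \<in> I \<Longrightarrow> Linf_le \<P> (i A) u) \<Longrightarrow> Linf_le \<P> s u"
    unfolding is_supremum_def by auto
  define \<sigma> where "\<sigma> = rep s"
  have \<sigma>: "\<sigma> \<in> bdd_measurable M" unfolding \<sigma>_def by (rule rep_bdd[OF s])
  note [measurable] = bdd_measurable_measurable[OF \<sigma>]
  have up: "qs \<P> (\<lambda>\<omega>. indicator A \<omega> \<le> \<sigma> \<omega>)" if "A \<in> I" for A
    using up[OF that] Linf_le_cls_iff(2)[OF s ind[OF that]] unfolding i_def \<sigma>_def by simp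
  have least: "qs \<P> (\<lambda>\<omega>. \<sigma> \<omega> \<le> Y \<omega>)"
    if Y: "Y \<in> bdd_measurable M" "\<And>A. A \<in> I \<Longrightarrow> qs \<P> (\<lambda>\<omega>. indicator A \<omega> \<le> Y \<omega>)" for Y
    using least[OF cls_in_Linf[OF Y(1)]] Y(2) Linf_le_cls_cls_iff[OF ind Y(1)]
      Linf_le_cls_iff(1)[OF s Y(1)] unfolding i_def \<sigma>_def by simp
  \<comment> \<open>The net \<open>\<sigma> - indicator A\<close> decreases to 0 along the null
    events; order continuity will be applied to it.\<close>
  define X where "X A = (\<lambda>\<omega>. \<sigma> \<omega> - indicator A \<omega>)" for A
  have X: "X A \<in> bdd_measurable M" if "A \<in> I" for A
    unfolding X_def by (rule bdd_measurable_diff[OF \<sigma> ind[OF that]])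
  \<comment> \<open>Integration against \<open>N\<close>, an element of the order continuous dual
    because \<open>N\<close> corresponds to a member of \<open>ca_c\<close>.\<close>
  define l where "l = (\<lambda>a\<in>Linf M \<P>. signed_integral M (density_charge N (\<lambda>_. 1)) (rep a))"
  have "l \<in> order_continuous_dual M \<P>"
    using ocd density_charge_1_in_ca_c[OF N] unfolding order_continuous_dual_eq_ca_c_def l_def
    by (auto dest: bij_betw_imp_surj_on)
  then have "order_continuous M \<P> l" unfolding order_continuous_def order_continuous_dual_def by blast
  moreover have "directed_set I (\<subseteq>)"
    unfolding directed_set_def
  proof (intro conjI ballI impI)
    show "I \<noteq> {}" using \<open>{} \<in> I\<close> by blast
    show "\<exists>C\<in>I. A \<subseteq> C \<and> B \<subseteq> C" if "A \<in> I" "B \<in> I" for A B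
    proof (intro bexI[of _ "A \<union> B"])
      have "measure N (A \<union> B) \<le> measure N A + measure N B"
        using that setsN unfolding I_def by (intro measure_Un_le) auto
      then show "A \<union> B \<in> I" using that unfolding I_def by (auto simp: measure_le_0_iff)
    qed auto
  qed auto
  moreover have "\<forall>A\<in>I. cls M \<P> (X A) \<in> Linf M \<P>" using X cls_in_Linf by blast
  moreover have "order_converges_zero M \<P> I (\<subseteq>) (\<lambda>A. cls M \<P> (X A))"
    unfolding order_converges_zero_def
  proof (intro exI[of _ "\<lambda>A. cls M \<P> (X A)"] conjI ballI impI)
    show "cls M \<P> (X A) \<in> Linf M \<P>" if "A \<in> I" for A using X[OF that] by (rule cls_in_Linf)
    show "Linf_le \<P> (cls M \<P> (X B)) (cls M \<P> (X A))" if "A \<in> I" "B \<in> I" "A \<subseteq> B" for A B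
      unfolding Linf_le_cls_cls_iff[OF X[OF that(2)] X[OF that(1)]] using that(3)
      unfolding X_def qs_def by (auto simp: indicator_def intro!: AE_I2)
    show "Linf_le \<P> (Linf_abs M \<P> (cls M \<P> (X A))) (cls M \<P> (X A))" if "A \<in> I" for A
    proof -
      note XA = X[OF that]
      have "qs \<P> (\<lambda>\<omega>. \<bar>rep (cls M \<P> (X A)) \<omega>\<bar> \<le> X A \<omega>)"
        by (rule qs_mono[OF qs_conj[OF rep_cls[OF XA] up[OF that]]]) (simp add: X_def)
      then show ?thesis
        unfolding Linf_abs_def
          Linf_le_cls_cls_iff[OF bdd_measurable_abs[OF rep_bdd[OF cls_in_Linf[OF XA]]] XA] .
    qed
    \<comment> \<open>A lower bound \<open>u\<close> of the net gives
      \<open>indicator A \<le> \<sigma> - u\<close> for every null event \<open>A\<close>. Thus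
      \<open>\<sigma> - u\<close> is an upper bound of the indicators, and minimality of
      \<open>\<sigma>\<close> yields \<open>u \<le> 0\<close>.\<close>
    show "is_infimum M \<P> ((\<lambda>A. cls M \<P> (X A)) ` I) (cls M \<P> (\<lambda>_. 0))"
      unfolding is_infimum_def
    proof (intro conjI ballI impI)
      show "cls M \<P> (\<lambda>_. 0) \<in> Linf M \<P>" by (intro cls_in_Linf bdd_measurable_const)
      show "Linf_le \<P> (cls M \<P> (\<lambda>_. 0)) d" if d: "d \<in> (\<lambda>A. cls M \<P> (X A)) ` I" for d
      proof -
        obtain A where A: "A \<in> I" "d = cls M \<P> (X A)" using d by blast
        show ?thesis
          unfolding A(2) Linf_le_cls_cls_iff[OF bdd_measurable_const X[OF A(1)]]
          by (rule qs_mono[OF up[OF A(1)]]) (simp add: X_def)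
      qed
      show "Linf_le \<P> u (cls M \<P> (\<lambda>_. 0))"
        if u: "u \<in> Linf M \<P>" "\<forall>d\<in>(\<lambda>A. cls M \<P> (X A)) ` I. Linf_le \<P> u d" for u
      proof -
        have "qs \<P> (\<lambda>\<omega>. indicator A \<omega> \<le> \<sigma> \<omega> - rep u \<omega>)" if A: "A \<in> I" for A
        proof (rule qs_mono)
          show "qs \<P> (\<lambda>\<omega>. rep u \<omega> \<le> X A \<omega>)"
            using u(2) A Linf_le_cls_iff(1)[OF u(1) X[OF A]] by blast
        qed (simp add: X_def algebra_simps)
        then have "qs \<P> (\<lambda>\<omega>. \<sigma> \<omega> \<le> \<sigma> \<omega> - rep u \<omega>)"
          by (intro least bdd_measurable_diff[OF \<sigma> rep_bdd[OF u(1)]])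
        then show ?thesis
          unfolding Linf_le_cls_iff(1)[OF u(1) bdd_measurable_const] by (rule qs_mono) simp
      qed
    qed
  qed
  \<comment> \<open>The indices are events rather than classes, hence the passage to nets with
    arbitrary index type.\<close>
  ultimately have null: "net_null I (\<subseteq>) (\<lambda>A. l (cls M \<P> (X A)))"
    by (rule order_continuous_all_nets)
  \<comment> \<open>Null events do not affect the integral, so the net of values is constant;
    converging to 0, it forces the integral of \<open>\<sigma>\<close> to be 0.\<close>
  have l_X: "l (cls M \<P> (X A)) = (\<integral>\<omega>. \<sigma> \<omega> \<partial>N)" if A: "A \<in> I" for A
  proof -
    note c = cls_in_Linf[OF X[OF A]]
    have "l (cls M \<P> (X A)) = (\<integral>\<omega>. rep (cls M \<P> (X A)) \<omega> \<partial>N)"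
      unfolding l_def using c by (simp add: signed_integral_dominated[OF N rep_bdd])
    also have "\<dots> = (\<integral>\<omega>. X A \<omega> \<partial>N)" by (rule integral_cong_qs[OF N rep_cls[OF X[OF A]] rep_bdd[OF c] X[OF A]])
    also have "\<dots> = (\<integral>\<omega>. \<sigma> \<omega> \<partial>N) - (\<integral>\<omega>. indicator A \<omega> \<partial>N)"
      unfolding X_def by (intro Bochner_Integration.integral_diff integrable_dominated[OF N] \<sigma> ind[OF A])
    also have "(\<integral>\<omega>. indicator A \<omega> \<partial>N) = (0::real)"
      using A setsN sets.sets_into_space[of A N] unfolding I_def by (simp add: Int_absorb2)
    finally show ?thesis by simp
  qed
  have "\<bar>\<integral>\<omega>. \<sigma> \<omega> \<partial>N\<bar> \<le> 0"
  proof (rule field_le_epsilon)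
    fix e :: real assume "0 < e"
    then obtain A where "A \<in> I" "\<bar>l (cls M \<P> (X A))\<bar> < e" using null unfolding net_null_def by blast
    then show "\<bar>\<integral>\<omega>. \<sigma> \<omega> \<partial>N\<bar> \<le> 0 + e" using l_X by simp
  qed
  then have int0: "(\<integral>\<omega>. \<sigma> \<omega> \<partial>N) = 0" by simp
  have "qs \<P> (\<lambda>\<omega>. 0 \<le> \<sigma> \<omega>)" using up[OF \<open>{} \<in> I\<close>] by simp
  then have "AE \<omega> in N. 0 \<le> \<sigma> \<omega>" by (rule AE_dominated_le[OF N _ bdd_measurable_const \<sigma>])
  then have "AE \<omega> in N. \<sigma> \<omega> = 0"
    using int0 integral_nonneg_eq_0_iff_AE[OF integrable_dominated[OF N \<sigma>]] by blast
  \<comment> \<open>Off \<open>S\<close> the function \<open>\<sigma>\<close> is positive, which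
    happens with \<open>N\<close>-measure 0. The indicator of an \<open>N\<close>-null event inside
    \<open>S\<close> lies quasi-surely below \<open>\<sigma>\<close>, which is at most 0 on
    \<open>S\<close>, so the event is polar.\<close>
  define S where "S = {\<omega>\<in>space M. \<sigma> \<omega> \<le> 0}"
  have S: "S \<in> sets M" unfolding S_def by measurable
  show thesis
  proof (rule that[OF S])
    have "AE \<omega> in N. \<omega> \<notin> space M - S" using \<open>AE \<omega> in N. \<sigma> \<omega> = 0\<close> by eventually_elim (simp add: S_def)
    then have "space M - S \<in> null_sets N" using S setsN by (subst (asm) AE_iff_null_sets[symmetric]) auto
    then show "measure N (space M - S) = 0" by (auto simp: measure_def)
    fix A assume A: "A \<in> sets M" "A \<subseteq> S" "measure N A = 0"
    then have "A \<in> I" unfolding I_def by simp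
    have "qs \<P> (\<lambda>\<omega>. \<omega> \<notin> A)"
      by (rule qs_mono[OF up[OF \<open>A \<in> I\<close>]]) (use A(2) in \<open>auto simp: S_def indicator_def split: if_splits\<close>)
    moreover have "{\<omega>\<in>space M. \<not> \<omega> \<notin> A} = A" using sets.sets_into_space[OF A(1)] by blast
    ultimately show "polar A" using qs_iff_polar[of "\<lambda>\<omega>. \<omega> \<notin> A"] A(1) by simp
  qed
qed

text \<open>Completeness is used twice, for the support of a measure and for the supremum
  \<open>s\<close>; the identification of the order continuous dual enters through
  \<open>order_support\<close>. The supremum is formed before any measure is fixed, so a single
  class represents \<open>\<phi>\<close> on all of \<open>ca_c\<close>.\<close>

theorem dual_if_order_complete:
  assumes complete: "Linf_order_complete M \<P>" and ocd: "order_continuous_dual_eq_ca_c M \<P>"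
  shows "ca_c_dual_eq_Linf M \<P>"
  unfolding ca_c_dual_eq_Linf_def
proof
  fix \<phi> assume \<phi>: "\<phi> \<in> ca_c_dual M \<P>"
  have add: "\<phi> (\<lambda>A. \<mu> A + \<nu> A) = \<phi> \<mu> + \<phi> \<nu>" if "\<mu> \<in> ca_c M \<P>" "\<nu> \<in> ca_c M \<P>" for \<mu> \<nu>
    using \<phi> that unfolding ca_c_dual_def by blast
  have scale: "\<phi> (\<lambda>A. r * \<mu> A) = r * \<phi> \<mu>" if "\<mu> \<in> ca_c M \<P>" for r \<mu>
    using \<phi> that unfolding ca_c_dual_def by blast
  obtain K0 where K0: "\<And>\<mu>. \<mu> \<in> ca_c M \<P> \<Longrightarrow> \<bar>\<phi> \<mu>\<bar> \<le> K0 * tv_norm M \<mu>"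
    using \<phi> unfolding ca_c_dual_def by blast
  define K where "K = \<bar>K0\<bar>"
  have K: "0 \<le> K" unfolding K_def by simp
  have bound: "\<bar>\<phi> (density_charge N f)\<bar> \<le> K * (\<integral>\<omega>. \<bar>f \<omega>\<bar> \<partial>N)" if N: "dominated N" "integrable N f" for N f
  proof -
    note \<mu> = density_charge_in_ca_c[OF N]
    have "\<bar>\<phi> (density_charge N f)\<bar> \<le> K0 * tv_norm M (density_charge N f)" by (rule K0[OF \<mu>])
    also have "\<dots> \<le> K * tv_norm M (density_charge N f)"
      unfolding K_def by (intro mult_right_mono) (auto simp: tv_norm_eq[OF ca_c_in_ca[OF \<mu>]])
    also have "\<dots> \<le> K * (\<integral>\<omega>. \<bar>f \<omega>\<bar> \<partial>N)"
      by (intro mult_left_mono tv_norm_density_charge_le[OF N(2) dominatedD(2)[OF N(1)]] K)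
    finally show ?thesis .
  qed
  define \<psi> where "\<psi> N = \<phi> (density_charge N (\<lambda>_. 1))" for N
  have \<psi>_bound: "\<bar>\<psi> N\<bar> \<le> K * measure N (space M)" if "dominated N" for N
    using bound[OF that finite_measure.integrable_const[OF dominatedD(1)[OF that]], of 1]
      dominatedD(3)[OF that] unfolding \<psi>_def by simp
  \<comment> \<open>Passing from \<open>f\<close> to \<open>f dN\<close> carries
    \<open>L1(N)\<close> into \<open>ca_c\<close> without increasing the norm, so
    \<open>\<phi>\<close> induces a bounded functional on \<open>L1(N)\<close>.\<close>
  have repr: "\<exists>Z. Z \<in> borel_measurable N \<and> (\<forall>\<omega>. \<bar>Z \<omega>\<bar> \<le> K) \<and>
      (\<forall>f. integrable N f \<longrightarrow> \<phi> (density_charge N f) = (\<integral>\<omega>. f \<omega> * Z \<omega> \<partial>N))" if N: "dominated N" for N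
  proof (rule L1_dual_representation[OF dominatedD(1)[OF N], of "\<lambda>f. \<phi> (density_charge N f)" K])
    show "\<phi> (density_charge N (\<lambda>\<omega>. f \<omega> + g \<omega>)) = \<phi> (density_charge N f) + \<phi> (density_charge N g)"
      if "integrable N f" "integrable N g" for f g
      unfolding density_charge_add[OF that] by (intro add density_charge_in_ca_c N that)
    show "\<phi> (density_charge N (\<lambda>\<omega>. c * f \<omega>)) = c * \<phi> (density_charge N f)" if "integrable N f" for c f
      unfolding density_charge_scale by (intro scale density_charge_in_ca_c N that)
    show "\<bar>\<phi> (density_charge N f)\<bar> \<le> K * (\<integral>\<omega>. \<bar>f \<omega>\<bar> \<partial>N)" if "integrable N f" for f
      by (rule bound[OF N that])
  qed (use K in auto)
  \<comment> \<open>Restriction is encoded as a density so that the result is again a dominated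
    measure on all of \<open>sets M\<close>.\<close>
  define restr where "restr N A = density N (\<lambda>\<omega>. ennreal (indicator A \<omega>))" for N :: "'a measure" and A
  have restr: "dominated (restr N A)" "\<psi> (restr N A) = \<phi> (density_charge N (indicator A))"
    "\<And>X. X \<in> bdd_measurable M \<Longrightarrow> (\<integral>\<omega>. X \<omega> \<partial>restr N A) = (\<integral>\<omega>. indicator A \<omega> * X \<omega> \<partial>N)"
    "\<And>B. B \<in> sets M \<Longrightarrow> measure (restr N A) B = measure N (A \<inter> B)"
    if N: "dominated N" and A: "A \<in> sets M" for N A
  proof -
    have iA: "integrable N (indicator A :: 'a \<Rightarrow> real)"
      by (rule integrable_dominated[OF N bdd_measurable_indicator[OF A]])
    show "dominated (restr N A)" unfolding restr_def by (intro dominated_density N iA) simp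
    show "\<psi> (restr N A) = \<phi> (density_charge N (indicator A))"
      unfolding \<psi>_def restr_def by (subst density_charge_density[OF iA]) auto
    show "(\<integral>\<omega>. X \<omega> \<partial>restr N A) = (\<integral>\<omega>. indicator A \<omega> * X \<omega> \<partial>N)" if "X \<in> bdd_measurable M" for X
      unfolding restr_def using borel_measurable_integrable[OF integrable_dominated[OF N that]] iA
      by (subst integral_density) auto
    show "measure (restr N A) B = measure N (A \<inter> B)" if B: "B \<in> sets M" for B
    proof -
      have "measure (restr N A) B = (\<integral>\<omega>. indicator A \<omega> * indicator B \<omega> \<partial>N)"
        unfolding restr_def using B dominatedD(2)[OF N] by (intro measure_density_real iA) auto
      also have "\<dots> = (\<integral>\<omega>. indicator (A \<inter> B) \<omega> \<partial>N)" by (simp add: indicator_inter_arith)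
      also have "\<dots> = measure N (A \<inter> B)"
        using A B dominatedD[OF N] sets.sets_into_space[OF A] by (simp add: Int_absorb2 inf.coboundedI1)
      finally show ?thesis .
    qed
  qed
  have \<psi>_split: "\<psi> N = \<psi> (restr N A) + \<psi> (restr N (space M - A))"
    if N: "dominated N" and A: "A \<in> sets M" for N A
  proof -
    have iA: "integrable N (indicator A :: 'a \<Rightarrow> real)" "integrable N (indicator (space M - A) :: 'a \<Rightarrow> real)"
      using A by (auto intro!: integrable_dominated[OF N bdd_measurable_indicator])
    have "density_charge N (\<lambda>_. 1) = density_charge N (\<lambda>\<omega>. indicator A \<omega> + indicator (space M - A) \<omega>)"
      unfolding density_charge_def dominatedD(3)[OF N, symmetric]
      by (auto simp: fun_eq_iff indicator_def intro!: Bochner_Integration.integral_cong)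
    then show ?thesis
      unfolding \<psi>_def[of N] using A iA
      by (simp add: density_charge_add add density_charge_in_ca_c[OF N] restr(2)[OF N])
  qed
  \<comment> \<open>The lower bound \<open>- K\<close> is imposed to make the set norm bounded; the
    matching upper bound \<open>K\<close> follows from the integral inequalities.\<close>
  define D where "D = {a \<in> Linf M \<P>. qs \<P> (\<lambda>\<omega>. - K \<le> rep a \<omega>) \<and>
    (\<forall>N. dominated N \<longrightarrow> (\<integral>\<omega>. rep a \<omega> \<partial>N) \<le> \<psi> N)}"
  have D_le: "qs \<P> (\<lambda>\<omega>. rep a \<omega> \<le> K)" if a: "a \<in> D" for a
  proof (rule qs_leI)
    fix N assume N: "dominated N"
    have "(\<integral>\<omega>. rep a \<omega> \<partial>N) \<le> \<psi> N" using a N unfolding D_def by blast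
    also have "\<dots> \<le> K * measure N (space M)" using \<psi>_bound[OF N] by simp
    finally show "(\<integral>\<omega>. rep a \<omega> \<partial>N) \<le> (\<integral>\<omega>. K \<partial>N)" by (simp add: dominatedD(3)[OF N] mult.commute)
  qed (use a rep_bdd in \<open>auto simp: D_def\<close>)
  have cls_D: "cls M \<P> X \<in> D"
    if X: "X \<in> bdd_measurable M" "qs \<P> (\<lambda>\<omega>. - K \<le> X \<omega>)"
      "\<And>N. dominated N \<Longrightarrow> (\<integral>\<omega>. X \<omega> \<partial>N) \<le> \<psi> N" for X
  proof -
    note c = cls_in_Linf[OF X(1)]
    have "qs \<P> (\<lambda>\<omega>. - K \<le> rep (cls M \<P> X) \<omega>)"
      using qs_subst[OF rep_cls[OF X(1)], of "\<lambda>_ x. - K \<le> x"] X(2) by simp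
    moreover have "(\<integral>\<omega>. rep (cls M \<P> X) \<omega> \<partial>N) \<le> \<psi> N" if N: "dominated N" for N
      using integral_cong_qs[OF N rep_cls[OF X(1)] rep_bdd[OF c] X(1)] X(3)[OF N] by simp
    ultimately show ?thesis using c unfolding D_def by blast
  qed
  have neg_K: "cls M \<P> (\<lambda>_. - K) \<in> D"
  proof (rule cls_D)
    show "(\<integral>\<omega>. - K \<partial>N) \<le> \<psi> N" if N: "dominated N" for N
      using \<psi>_bound[OF N] by (simp add: dominatedD(3)[OF N] mult.commute abs_le_iff)
  qed (auto simp: qs_def)
  have "Linf_norm \<P> a \<le> K" if a: "a \<in> D" for a
  proof (rule Linf_norm_leI)
    show "a \<in> Linf M \<P>" using a unfolding D_def by blast
    have "qs \<P> (\<lambda>\<omega>. - K \<le> rep a \<omega>)" using a unfolding D_def by blast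
    from qs_conj[OF this D_le[OF a]] show "qs \<P> (\<lambda>\<omega>. \<bar>rep a \<omega>\<bar> \<le> K)" by (rule qs_mono) auto
  qed
  moreover have "D \<subseteq> Linf M \<P>" unfolding D_def by blast
  ultimately obtain s where "is_supremum M \<P> D s"
    using complete neg_K unfolding Linf_order_complete_def by blast
  then have s: "s \<in> Linf M \<P>" and up: "\<And>a. a \<in> D \<Longrightarrow> Linf_le \<P> a s"
    and least: "\<And>u. u \<in> Linf M \<P> \<Longrightarrow> (\<And>a. a \<in> D \<Longrightarrow> Linf_le \<P> a u) \<Longrightarrow> Linf_le \<P> s u"
    unfolding is_supremum_def by auto
  have \<psi>_eq: "\<psi> N = (\<integral>\<omega>. rep s \<omega> \<partial>N)" if N: "dominated N" for N
  proof -
    obtain S where S: "S \<in> sets M" "measure N (space M - S) = 0"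
      "\<And>A. A \<in> sets M \<Longrightarrow> A \<subseteq> S \<Longrightarrow> measure N A = 0 \<Longrightarrow> polar A"
      by (rule order_support[OF complete ocd N]) blast
    obtain Z where Z: "Z \<in> borel_measurable N" "\<And>\<omega>. \<bar>Z \<omega>\<bar> \<le> K"
      "\<And>f. integrable N f \<Longrightarrow> \<phi> (density_charge N f) = (\<integral>\<omega>. f \<omega> * Z \<omega> \<partial>N)"
      using repr[OF N] by blast
    have Zb: "Z \<in> bdd_measurable M"
      using Z(1,2) measurable_cong_sets[OF dominatedD(2)[OF N] refl] by (intro bdd_measurableI[of _ _ K]) auto
    text \<open>On \<open>S\<close> every dominated measure is absolutely continuous with respect to \<open>N\<close>, so one density
      represents the functional for all of them.\<close>
    have Z_restr: "\<psi> (restr Q A) = (\<integral>\<omega>. Z \<omega> \<partial>restr Q A)"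
      if Q: "dominated Q" and A: "A \<in> sets M" "A \<subseteq> S" for Q A
    proof -
      note R = restr(1)[OF Q A(1)]
      have "measure (restr Q A) B = 0" if B: "B \<in> sets N" "measure N B = 0" for B
      proof -
        interpret finite_measure N by (rule dominatedD(1)[OF N])
        have BM: "B \<in> sets M" using B dominatedD(2)[OF N] by simp
        have "measure N (A \<inter> B) \<le> measure N B" using B by (intro finite_measure_mono) auto
        then have "polar (A \<inter> B)"
          using A BM B(2) measure_nonneg[of N "A \<inter> B"] by (intro S(3)) auto
        then show ?thesis using Q restr(4)[OF Q A(1) BM] unfolding dominated_def by simp
      qed
      then obtain g where g: "integrable N g" "\<And>\<omega>. 0 \<le> g \<omega>" "restr Q A = density N (\<lambda>\<omega>. ennreal (g \<omega>))"
        using finite_measure_ac_density[OF dominatedD(1)[OF N] dominatedD(1)[OF R]]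
          dominatedD(2)[OF N] dominatedD(2)[OF R] by metis
      have "\<psi> (restr Q A) = (\<integral>\<omega>. g \<omega> * Z \<omega> \<partial>N)"
        unfolding \<psi>_def g(3) density_charge_density[OF g(1,2)] by (rule Z(3)[OF g(1)])
      also have "\<dots> = (\<integral>\<omega>. Z \<omega> \<partial>restr Q A)"
        unfolding g(3) using g Z(1) by (subst integral_density) auto
      finally show ?thesis .
    qed
    \<comment> \<open>\<open>Z\<close> on \<open>S\<close>, continued off \<open>S\<close> by a
      constant: \<open>c = - K\<close> will give a member of \<open>D\<close>, and
      \<open>c = K\<close> an upper bound of \<open>D\<close>.\<close>
    define w where "w c \<omega> = indicator S \<omega> * Z \<omega> + c * indicator (space M - S) \<omega>" for c \<omega>
    have bS: "(\<lambda>\<omega>. indicator S \<omega> * Z \<omega>) \<in> bdd_measurable M"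
      "(\<lambda>\<omega>. c * indicator (space M - S) \<omega>) \<in> bdd_measurable M" for c
      using S(1) by (intro bdd_measurable_mult bdd_measurable_indicator Zb bdd_measurable_const; simp)+
    have w: "w c \<in> bdd_measurable M" for c
      unfolding w_def by (intro bdd_measurable_add bS)
    have w_int: "(\<integral>\<omega>. w c \<omega> \<partial>Q) = \<psi> (restr Q S) + c * measure Q (space M - S)" if Q: "dominated Q" for Q c
    proof -
      have "(\<integral>\<omega>. w c \<omega> \<partial>Q) = (\<integral>\<omega>. indicator S \<omega> * Z \<omega> \<partial>Q) + (\<integral>\<omega>. c * indicator (space M - S) \<omega> \<partial>Q)"
        unfolding w_def by (intro Bochner_Integration.integral_add integrable_dominated[OF Q] bS)
      then show ?thesis
        using Z_restr[OF Q S(1) subset_refl] restr(3)[OF Q S(1) Zb] dominatedD(3)[OF Q]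
        by (simp add: Int_absorb2)
    qed
    \<comment> \<open>The complement of \<open>S\<close> is \<open>N\<close>-null and contributes
      nothing to either side, so the choice of \<open>c\<close> is invisible to
      \<open>N\<close>.\<close>
    have w_N: "(\<integral>\<omega>. w c \<omega> \<partial>N) = \<psi> N" for c
    proof -
      note R = restr(1)[OF N sets.compl_sets[OF S(1)]]
      have "\<bar>\<psi> (restr N (space M - S))\<bar> \<le> K * measure (restr N (space M - S)) (space M)"
        by (rule \<psi>_bound[OF R])
      also have "measure (restr N (space M - S)) (space M) = 0"
        using restr(4)[OF N sets.compl_sets[OF S(1)] sets.top] S(2) by (simp add: Int_absorb2)
      finally show ?thesis using w_int[OF N] \<psi>_split[OF N S(1)] S(2) by simp
    qed
    \<comment> \<open>On \<open>S\<close> the integral equals the functional; off \<open>S\<close>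
      the functional is at least \<open>- K\<close> times the mass.\<close>
    have "cls M \<P> (w (- K)) \<in> D"
    proof (rule cls_D[OF w])
      show "qs \<P> (\<lambda>\<omega>. - K \<le> w (- K) \<omega>)"
        unfolding qs_def
      proof (intro ballI AE_I2)
        fix P \<omega>
        show "- K \<le> w (- K) \<omega>" using Z(2)[of \<omega>] K unfolding w_def by (auto simp: indicator_def abs_le_iff)
      qed
      fix Q assume Q: "dominated Q"
      note C = sets.compl_sets[OF S(1)]
      have "- \<psi> (restr Q (space M - S)) \<le> K * measure Q (space M - S)"
        using \<psi>_bound[OF restr(1)[OF Q C]] restr(4)[OF Q C sets.top] by (simp add: Int_absorb2 abs_le_iff)
      then show "(\<integral>\<omega>. w (- K) \<omega> \<partial>Q) \<le> \<psi> Q" using w_int[OF Q] \<psi>_split[OF Q S(1)] by simp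
    qed
    from up[OF this] have "qs \<P> (\<lambda>\<omega>. w (- K) \<omega> \<le> rep s \<omega>)" using Linf_le_cls_iff(2)[OF s w] by simp
    then have le: "\<psi> N \<le> (\<integral>\<omega>. rep s \<omega> \<partial>N)"
      using integral_mono_qs[OF N _ w rep_bdd[OF s]] w_N by metis
    have "Linf_le \<P> a (cls M \<P> (w K))" if a: "a \<in> D" for a
    proof -
      have aL: "a \<in> Linf M \<P>" using a unfolding D_def by blast
      note ra = rep_bdd[OF aL]
      have ind_S: "(indicator S :: 'a \<Rightarrow> real) \<in> bdd_measurable M" by (rule bdd_measurable_indicator[OF S(1)])
      \<comment> \<open>Restricting an arbitrary \<open>Q\<close> to \<open>S\<close> in the
        defining inequality of \<open>D\<close> compares \<open>a\<close> with \<open>Z\<close> on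
        \<open>S\<close>; off \<open>S\<close> the bound by \<open>K\<close> takes over.\<close>
      have "qs \<P> (\<lambda>\<omega>. indicator S \<omega> * rep a \<omega> \<le> indicator S \<omega> * Z \<omega>)"
      proof (rule qs_leI[OF bdd_measurable_mult[OF ind_S ra] bS(1)])
        fix Q assume Q: "dominated Q"
        have "(\<integral>\<omega>. indicator S \<omega> * rep a \<omega> \<partial>Q) = (\<integral>\<omega>. rep a \<omega> \<partial>restr Q S)"
          by (rule restr(3)[OF Q S(1) ra, symmetric])
        also have "\<dots> \<le> \<psi> (restr Q S)" using a restr(1)[OF Q S(1)] unfolding D_def by blast
        also have "\<dots> = (\<integral>\<omega>. indicator S \<omega> * Z \<omega> \<partial>Q)"
          using Z_restr[OF Q S(1) subset_refl] restr(3)[OF Q S(1) Zb] by simp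
        finally show "(\<integral>\<omega>. indicator S \<omega> * rep a \<omega> \<partial>Q) \<le> (\<integral>\<omega>. indicator S \<omega> * Z \<omega> \<partial>Q)" .
      qed
      from qs_conj[OF this D_le[OF a]]
      have "\<forall>P\<in>\<P>. AE \<omega> in P. rep a \<omega> \<le> w K \<omega>"
        unfolding qs_def
      proof (intro ballI)
        fix P assume *: "\<forall>P\<in>\<P>. AE \<omega> in P. indicator S \<omega> * rep a \<omega> \<le> indicator S \<omega> * Z \<omega> \<and> rep a \<omega> \<le> K"
          and P: "P \<in> \<P>"
        from *[rule_format, OF P] AE_space show "AE \<omega> in P. rep a \<omega> \<le> w K \<omega>"
          by eventually_elim (auto simp: w_def indicator_def space_eq[OF P] split: if_splits)
      qed
      then show ?thesis unfolding Linf_le_cls_iff(1)[OF aL w] qs_def .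
    qed
    from least[OF cls_in_Linf[OF w] this] have "qs \<P> (\<lambda>\<omega>. rep s \<omega> \<le> w K \<omega>)"
      using Linf_le_cls_iff(1)[OF s w] by simp
    then have "(\<integral>\<omega>. rep s \<omega> \<partial>N) \<le> \<psi> N"
      using integral_mono_qs[OF N _ rep_bdd[OF s] w] w_N by metis
    with le show ?thesis by simp
  qed
  show "\<exists>a\<in>Linf M \<P>. \<forall>\<mu>\<in>ca_c M \<P>. \<phi> \<mu> = signed_integral M \<mu> (rep a)"
  proof (intro bexI[OF _ s] ballI)
    fix \<mu> assume \<mu>: "\<mu> \<in> ca_c M \<P>"
    let ?p = "density_charge (pos_part M \<mu>) (\<lambda>_. 1)"
    let ?q = "density_charge (pos_part M (\<lambda>A. - \<mu> A)) (\<lambda>_. 1)"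
    note dom = dominated_pos_part[OF \<mu>]
    \<comment> \<open>The Jordan decomposition written with coefficient \<open>-1\<close>, so that
      additivity and homogeneity of \<open>\<phi>\<close> apply; off \<open>sets M\<close> both
      sides vanish.\<close>
    have "\<mu> = (\<lambda>A. ?p A + (-1) * ?q A)"
    proof
      fix A
      show "\<mu> A = ?p A + (-1) * ?q A"
      proof (cases "A \<in> sets M")
        case True
        then show ?thesis
          using ca_eq_diff[OF ca_c_in_ca[OF \<mu>] True] sets.sets_into_space[OF True]
          by (simp add: density_charge_def Int_absorb2)
      next
        case False
        then show ?thesis using ca_c_in_ca[OF \<mu>] by (simp add: density_charge_def ca_def)
      qed
    qed
    then have "\<phi> \<mu> = \<phi> (\<lambda>A. ?p A + (-1) * ?q A)" by simp
    also have "\<dots> = \<psi> (pos_part M \<mu>) + (-1) * \<psi> (pos_part M (\<lambda>A. - \<mu> A))"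
      unfolding \<psi>_def
      using add[OF density_charge_1_in_ca_c[OF dom(1)] ca_c_scale[OF density_charge_1_in_ca_c[OF dom(2)], of "-1"]]
        scale[OF density_charge_1_in_ca_c[OF dom(2)], of "-1"] by (simp only:)
    also have "\<dots> = signed_integral M \<mu> (rep s)"
      unfolding signed_integral_def \<psi>_eq[OF dom(1)] \<psi>_eq[OF dom(2)] by simp
    finally show "\<phi> \<mu> = signed_integral M \<mu> (rep s)" .
  qed
qed

end

theorem proposition3p10:
  fixes M :: "'a measure" and \<P> :: "'a measure set"
  assumes "\<P> \<noteq> {}"
    and "\<And>P. P \<in> \<P> \<Longrightarrow> prob_space P"
    and "\<And>P. P \<in> \<P> \<Longrightarrow> sets P = sets M"
  shows "(ca_c_dual_eq_Linf M \<P> \<longrightarrow> Linf_order_complete M \<P>) \<and>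
    (Linf_order_complete M \<P> \<and> order_continuous_dual_eq_ca_c M \<P> \<longrightarrow> ca_c_dual_eq_Linf M \<P>)"
proof -
  interpret prob_family M \<P> by (rule prob_family.intro) (use assms in auto)
  show ?thesis using order_complete_if_dual dual_if_order_complete by blast
qed

end
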